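(* Let $A\in\mathbb{R}^{n\times n}$ and $D\in\mathbb{R}^{p\times p}$ be symmetric positive definite, let $B\in\mathbb{R}^{m\times n}$ have full row rank, let $C\in\mathbb{R}^{p\times n}$, and let $P\in\mathbb{R}^{m\times m}$ be symmetric positive definite. Let $\mu_{\max}$ and $\nu_{\max}$ be the maximum eigenvalues of $A^{-1}B^TP^{-1}B$ and $A^{-1}C^TD^{-1}C$, respectively. Let $\omega,\tau,\theta$ be real numbers satisfying $0<\theta<2$ and $$0<\omega<\frac{4(2-\theta)}{(2-\theta)(2+\tau\mu_{\max})+2\theta\nu_{\max}},\qquad 0<\tau<\frac{4(\omega+\theta-\omega\theta)}{\omega\theta\mu_{\max}}.$$ Then the GSOR method with parameters $\omega,\tau,\theta$ and matrix $P$ is convergent, i.e., its iteration matrix $\mathcal{T}$ satisfies $\rho(\mathcal{T})<1$.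
   Context: The double saddle-point problem is the linear system $$\begin{pmatrix} A & B^T & C^T \\ B & 0 & 0 \\ C & 0 & -D \end{pmatrix} \begin{pmatrix} x \\ y \\ z \end{pmatrix} = \begin{pmatrix} f \\ g \\ h \end{pmatrix},$$ with $f\in\mathbb{R}^n$, $g\in\mathbb{R}^m$, $h\in\mathbb{R}^p$. The GSOR (generalized successive overrelaxation) method starts from any $(x_0,y_0,z_0)\in\mathbb{R}^{n+m+p}$ and iterates, for $k=0,1,\dots$, $$x_{k+1}=x_k+\omega A^{-1}(f-Ax_k-B^Ty_k-C^Tz_k),$$ $$y_{k+1}=y_k+\tau P^{-1}(Bx_{k+1}-g),$$ $$z_{k+1}=z_k+\theta D^{-1}(Cx_{k+1}-Dz_k-h).$$ Equivalently, with $w_k=(x_k,y_k,z_k)$, the iteration is $w_{k+1}=\mathcal{T}w_k+c$ for a fixed vector $c$, where the iteration matrix is $$\mathcal{T}=\begin{pmatrix} A & 0 & 0 \\ -\tau B & P & 0 \\ -\theta C & 0 & D \end{pmatrix}^{-1} \begin{pmatrix} (1-\omega)A & -\omega B^T & -\omega C^T \\ 0 & P & 0 \\ 0 & 0 & (1-\theta)D \end{pmatrix}.$$ The method is called convergent if and only if the spectral radius $\rho(\mathcal{T})$ is less than $1$. *)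

theory Defs
  imports
    "Jordan_Normal_Form.Spectral_Radius"
    "Jordan_Normal_Form.Gauss_Jordan_Elimination"
    "Jordan_Normal_Form.DL_Rank"
begin

definition sym_pos_def :: "nat \<Rightarrow> real mat \<Rightarrow> bool" where
  "sym_pos_def k M \<longleftrightarrow>
     M \<in> carrier_mat k k \<and> transpose_mat M = M \<and>
     (\<forall>v \<in> carrier_vec k. v \<noteq> 0\<^sub>v k \<longrightarrow> v \<bullet> (M *\<^sub>v v) > 0)"

text \<open>The library notion \<^const>\<open>mat_inverse\<close> yields an option; the value below is
  meaningful for invertible matrices only and unspecified otherwise.\<close>

definition mat_inv :: "'a :: field mat \<Rightarrow> 'a mat" where
  "mat_inv M = the (mat_inverse M)"

text \<open>The spectrum is taken over the reals. It is applied below to matrices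
  \<open>S\<^sup>-\<^sup>1 * N\<close> with \<open>S\<close> symmetric positive definite and \<open>N\<close> symmetric positive
  semidefinite, of positive dimension: these are similar to symmetric matrices, so the real
  spectrum is the full spectrum, and it is finite and nonempty.\<close>

definition max_eigenvalue :: "real mat \<Rightarrow> real" where
  "max_eigenvalue M = Max (spectrum M)"

definition append_cols :: "'a :: zero mat \<Rightarrow> 'a mat \<Rightarrow> 'a mat" where
  "append_cols X Y = four_block_mat X Y (0\<^sub>m 0 (dim_col X)) (0\<^sub>m 0 (dim_col Y))"

definition nine_block_mat ::
  "'a :: zero mat \<Rightarrow> 'a mat \<Rightarrow> 'a mat \<Rightarrow>
   'a mat \<Rightarrow> 'a mat \<Rightarrow> 'a mat \<Rightarrow>
   'a mat \<Rightarrow> 'a mat \<Rightarrow> 'a mat \<Rightarrow> 'a mat" where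
  "nine_block_mat M11 M12 M13
                  M21 M22 M23
                  M31 M32 M33 =
     four_block_mat (four_block_mat M11 M12 M21 M22) (M13 @\<^sub>r M23)
                    (append_cols M31 M32)            M33"

text \<open>One sweep
    \<open>x' = x + \<omega> A\<^sup>-\<^sup>1 (f - A x - B\<^sup>T y - C\<^sup>T z)\<close>,
    \<open>y' = y + \<tau> P\<^sup>-\<^sup>1 (B x' - g)\<close>,
    \<open>z' = z + \<theta> D\<^sup>-\<^sup>1 (C x' - D z - h)\<close>
  reads \<open>L w' = R w + (\<omega> f, -\<tau> g, -\<theta> h)\<close> for \<open>w = (x, y, z)\<close>, where \<open>L\<close> and \<open>R\<close> are
  the following two block matrices.\<close>

definition gsor_lhs ::
  "real mat \<Rightarrow> real mat \<Rightarrow> real mat \<Rightarrow> real mat \<Rightarrow> real mat \<Rightarrow> real \<Rightarrow> real \<Rightarrow> real mat" where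
  "gsor_lhs A B C D P \<tau> \<theta> =
     (let n = dim_row A; m = dim_row P; p = dim_row D in
      nine_block_mat
        A                 (0\<^sub>m n m)  (0\<^sub>m n p)
        ((- \<tau>) \<cdot>\<^sub>m B)   P          (0\<^sub>m m p)
        ((- \<theta>) \<cdot>\<^sub>m C)   (0\<^sub>m p m)  D)"

definition gsor_rhs ::
  "real mat \<Rightarrow> real mat \<Rightarrow> real mat \<Rightarrow> real mat \<Rightarrow> real mat \<Rightarrow> real \<Rightarrow> real \<Rightarrow> real mat" where
  "gsor_rhs A B C D P \<omega> \<theta> =
     (let n = dim_row A; m = dim_row P; p = dim_row D in
      nine_block_mat
        ((1 - \<omega>) \<cdot>\<^sub>m A)  ((- \<omega>) \<cdot>\<^sub>m transpose_mat B)  ((- \<omega>) \<cdot>\<^sub>m transpose_mat C)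
        (0\<^sub>m m n)          P                              (0\<^sub>m m p)
        (0\<^sub>m p n)          (0\<^sub>m p m)                      ((1 - \<theta>) \<cdot>\<^sub>m D))"

definition gsor_mat ::
  "real mat \<Rightarrow> real mat \<Rightarrow> real mat \<Rightarrow> real mat \<Rightarrow> real mat \<Rightarrow>
   real \<Rightarrow> real \<Rightarrow> real \<Rightarrow> real mat" where
  "gsor_mat A B C D P \<omega> \<tau> \<theta> =
     mat_inv (gsor_lhs A B C D P \<tau> \<theta>) * gsor_rhs A B C D P \<omega> \<theta>"

text \<open>The spectral radius ranges over all complex eigenvalues, hence the embedding.\<close>

definition gsor_convergent ::
  "real mat \<Rightarrow> real mat \<Rightarrow> real mat \<Rightarrow> real mat \<Rightarrow> real mat \<Rightarrow>
   real \<Rightarrow> real \<Rightarrow> real \<Rightarrow> bool" where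
  "gsor_convergent A B C D P \<omega> \<tau> \<theta> \<longleftrightarrow>
     spectral_radius (map_mat complex_of_real (gsor_mat A B C D P \<omega> \<tau> \<theta>)) < 1"

end

theory Submission
  imports Defs "HOL-Analysis.Function_Topology"
begin

text \<open>
  Let \<open>(x, y, z)\<close> be an eigenvector of the iteration matrix for an eigenvalue \<open>l\<close> with
  \<open>1 \<le> \<bar>l\<bar>\<close>. Full row rank of \<open>B\<close> and \<open>\<bar>1 - \<theta>\<bar> < 1\<close> exclude \<open>x = 0\<close>. Otherwise
  put \<open>a = x\<^sup>* A x\<close>, \<open>b = x\<^sup>* B\<^sup>T P\<^sup>-\<^sup>1 B x\<close>, \<open>c = x\<^sup>* C\<^sup>T D\<^sup>-\<^sup>1 C x\<close>. Pairing the block rows with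
  \<open>x\<close>, \<open>P\<^sup>-\<^sup>1 B x\<close>, \<open>D\<^sup>-\<^sup>1 C x\<close> and eliminating \<open>y\<close> and \<open>z\<close> gives, with \<open>\<beta> = \<omega> \<tau> b / a\<close> and
  \<open>\<gamma> = \<omega> \<theta> c / a\<close>, the cubic
    \<open>(l - 1 + \<omega>) (l - 1) (l - 1 + \<theta>) + \<beta> l (l - 1 + \<theta>) + \<gamma> l (l - 1) = 0\<close>.
  The Cayley transform \<open>s = (l - 1) / (l + 1)\<close> maps \<open>1 \<le> \<bar>l\<bar>\<close> to \<open>0 \<le> Re s\<close> and the cubic to
  one whose leading coefficient is positive by the bound on \<open>\<omega>\<close>, whose quadratic coefficient is
  positive by the bound on \<open>\<tau>\<close>, and which satisfies the Routh-Hurwitz inequality. So \<open>s = 0\<close>,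
  that is \<open>l = 1\<close>, and then \<open>B x = 0\<close> and \<open>a + c = 0\<close>, a contradiction. The bounds
  \<open>b \<le> \<mu> a\<close> and \<open>c \<le> \<nu> a\<close> hold because a maximiser of the Rayleigh quotient
  \<open>v \<bullet> N v / v \<bullet> A v\<close>, which exists by compactness, is an eigenvector of \<open>A\<^sup>-\<^sup>1 N\<close>.
\<close>

section \<open>The scalar stability analysis\<close>

text \<open>Since \<open>a0\<close> may vanish, the origin stays possible; all other roots lie in
  the open left half-plane. A positive real root would make the left side positive. For a nonreal
  root the imaginary part determines \<open>q\<^sup>2\<close>, and the real part then equates a
  positive quantity with zero.\<close>

lemma routh_hurwitz_cubic:
  fixes a0 a1 a2 a3 :: real and s :: complex
  assumes pos: "0 < a3" "0 < a2" "0 < a1" "0 \<le> a0"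
    and det: "a3 * a0 < a2 * a1"
    and root: "of_real a3 * s ^ 3 + of_real a2 * s\<^sup>2 + of_real a1 * s + of_real a0 = 0"
    and re: "0 \<le> Re s"
  shows "s = 0"
proof (rule ccontr)
  assume "s \<noteq> 0"
  define p q where "p = Re s" and "q = Im s"
  have s: "s = Complex p q" by (simp add: p_def q_def)
  have p: "0 \<le> p" using re by (simp add: p_def)
  have re_eq: "a3 * (p ^ 3 - 3 * p * q\<^sup>2) + a2 * (p\<^sup>2 - q\<^sup>2) + a1 * p + a0 = 0"
    using arg_cong[OF root, of Re]
    by (simp add: s complex_eq_iff power2_eq_square power3_eq_cube algebra_simps)
  have im_eq: "q * (a3 * (3 * p\<^sup>2 - q\<^sup>2) + 2 * a2 * p + a1) = 0"
    using arg_cong[OF root, of Im]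
    by (simp add: s complex_eq_iff power2_eq_square power3_eq_cube algebra_simps)
  show False
  proof (cases "q = 0")
    case True
    then have "0 < p" using p \<open>s \<noteq> 0\<close> by (auto simp: s complex_eq_iff)
    then have "0 < a3 * p ^ 3 + a2 * p\<^sup>2 + a1 * p + a0"
      using pos by (intro add_pos_nonneg add_pos_pos) auto
    then show False using re_eq True by simp
  next
    case False
    then have "a3 * (3 * p\<^sup>2 - q\<^sup>2) + 2 * a2 * p + a1 = 0"
      using im_eq by simp
    then have q2: "a3 * q\<^sup>2 = 3 * a3 * p\<^sup>2 + 2 * a2 * p + a1"
      by (simp add: algebra_simps)
    \<comment> \<open>The extra factor \<open>a3\<close> lets \<open>q\<^sup>2\<close> occur only as
      \<open>a3 * q\<^sup>2\<close>, which \<open>q2\<close> replaces without a division.\<close>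
    have "a3 * (a3 * p ^ 3 + a2 * p\<^sup>2 + a1 * p + a0) = a3 * q\<^sup>2 * (3 * a3 * p + a2)"
      using arg_cong[OF re_eq, of "\<lambda>t. a3 * t"] by (simp add: algebra_simps)
    \<comment> \<open>Eliminating \<open>q\<^sup>2\<close> leaves a real cubic in \<open>p\<close> whose constant term is the
      Hurwitz determinant and whose other coefficients are positive.\<close>
    then have "8 * a3\<^sup>2 * p ^ 3 + 8 * a3 * a2 * p\<^sup>2 + (2 * a2\<^sup>2 + 2 * a3 * a1) * p
        + (a2 * a1 - a3 * a0) = 0"
      unfolding q2 by (simp add: power2_eq_square power3_eq_cube algebra_simps)
    moreover have "0 \<le> 8 * a3\<^sup>2 * p ^ 3 + 8 * a3 * a2 * p\<^sup>2 + (2 * a2\<^sup>2 + 2 * a3 * a1) * p"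
      using pos p by simp
    ultimately show False using det by linarith
  qed
qed

text \<open>The two products are those of the Hurwitz condition for the Cayley-transformed cubic.
  Their terms \<open>\<theta> * \<beta> * q\<close> cancel, and the difference collapses to \<open>8
  * \<omega> * (\<theta> * S + (1 - \<theta>) * \<beta>) + 8 * S * \<gamma>\<close>.\<close>

lemma gsor_hurwitz_determinant:
  fixes \<omega> \<theta> \<beta> \<gamma> :: real
  assumes \<theta>: "0 < \<theta>" "\<theta> < 2" and \<omega>: "0 < \<omega>" "\<omega> < 2" and nn: "0 \<le> \<beta>" "0 \<le> \<gamma>"
    and up: "2 * \<gamma> < (2 - \<theta>) * (4 - 2 * \<omega> - \<beta>)"
    and q: "q = (2 - \<theta>) * \<beta> + 2 * \<gamma>" and S: "S = \<omega> + \<theta> - \<omega> * \<theta>"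
  shows "0 < S" "(2 * (2 - \<omega>) * (2 - \<theta>) - q) * (\<theta> * \<beta>) < (4 * S - \<theta> * \<beta>) * (2 * \<omega> * \<theta> + q)"
proof -
  \<comment> \<open>This sum is \<open>2 * S\<close>.\<close>
  have "0 < (2 - \<omega>) * \<theta> + \<omega> * (2 - \<theta>)" using \<theta> \<omega> by (simp add: add_pos_pos)
  then show S0: "0 < S" by (simp add: S algebra_simps)
  have \<beta>: "\<beta> < 4 - 2 * \<omega>"
  proof -
    have "0 < (2 - \<theta>) * (4 - 2 * \<omega> - \<beta>)" using up nn by linarith
    then show ?thesis using \<theta> by (simp add: zero_less_mult_iff)
  qed
  \<comment> \<open>The sign is in doubt only for \<theta> > 1. There \<beta> is replaced by its
    upper bound \<open>4 - 2 * \<omega>\<close>, and what remains is a square plus a product of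
    nonnegative factors.\<close>
  have key: "0 < \<theta> * S + (1 - \<theta>) * \<beta>"
  proof (cases "\<theta> \<le> 1")
    case True
    then show ?thesis using S0 \<theta> nn by (simp add: add_pos_nonneg)
  next
    case False
    then have "(\<theta> - 1) * \<beta> < (\<theta> - 1) * (4 - 2 * \<omega>)" using \<beta> by simp
    moreover have "\<theta> * S - (\<theta> - 1) * (4 - 2 * \<omega>) = (\<theta> - 2)\<^sup>2 + \<omega> * (\<theta> - 1) * (2 - \<theta>)"
      by (simp add: S power2_eq_square algebra_simps)
    moreover have "0 \<le> (\<theta> - 2)\<^sup>2 + \<omega> * (\<theta> - 1) * (2 - \<theta>)" using False \<theta> \<omega> by simp
    ultimately show ?thesis by (simp add: algebra_simps)
  qed
  have "(4 * S - \<theta> * \<beta>) * (2 * \<omega> * \<theta> + q) - (2 * (2 - \<omega>) * (2 - \<theta>) - q) * (\<theta> * \<beta>)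
      = 8 * \<omega> * (\<theta> * S + (1 - \<theta>) * \<beta>) + 8 * S * \<gamma>"
    by (simp add: q S algebra_simps)
  moreover have "0 < 8 * \<omega> * (\<theta> * S + (1 - \<theta>) * \<beta>) + 8 * S * \<gamma>"
    using key \<omega> S0 nn by (simp add: add_pos_nonneg)
  ultimately show "(2 * (2 - \<omega>) * (2 - \<theta>) - q) * (\<theta> * \<beta>) < (4 * S - \<theta> * \<beta>) * (2 * \<omega> * \<theta> + q)" by linarith
qed

text \<open>The assumptions \<open>up\<close> and \<open>up'\<close> are exactly the positivity of
  the leading and of the quadratic coefficient after the Cayley transform, so only the Hurwitz
  inequality has to be supplied.\<close>

lemma gsor_cubic_root:
  fixes \<omega> \<theta> \<beta> \<gamma> :: real and l :: complex
  assumes \<theta>: "0 < \<theta>" "\<theta> < 2" and \<omega>: "0 < \<omega>" "\<omega> < 2" and nn: "0 \<le> \<beta>" "0 \<le> \<gamma>"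
    and up: "2 * \<gamma> < (2 - \<theta>) * (4 - 2 * \<omega> - \<beta>)"
    and up': "\<theta> * \<beta> < 4 * (\<omega> + \<theta> - \<omega> * \<theta>)"
    and root: "(l - 1 + \<omega>) * (l - 1) * (l - 1 + \<theta>) + \<beta> * l * (l - 1 + \<theta>) + \<gamma> * l * (l - 1) = 0"
    and l: "1 \<le> norm l"
  shows "l = 1"
proof -
  define q where "q = (2 - \<theta>) * \<beta> + 2 * \<gamma>"
  define S where "S = \<omega> + \<theta> - \<omega> * \<theta>"
  note hd = gsor_hurwitz_determinant[OF \<theta> \<omega> nn up q_def S_def]
  define a3 a2 a1 a0 where "a3 = 2 * (2 - \<omega>) * (2 - \<theta>) - q" and "a2 = 4 * S - \<theta> * \<beta>"
    and "a1 = 2 * \<omega> * \<theta> + q" and "a0 = \<theta> * \<beta>"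
  note a_defs = a3_def a2_def a1_def a0_def
  have pos: "0 < a3" "0 < a2" "0 < a1" "0 \<le> a0" "a3 * a0 < a2 * a1"
  proof -
    show "0 < a3" using up by (simp add: a3_def q_def algebra_simps)
    show "0 < a2" using up' by (simp add: a2_def S_def)
    show "0 < a1" unfolding a1_def q_def using \<theta> \<omega> nn by (intro add_pos_nonneg) auto
    show "0 \<le> a0" using \<theta> nn by (simp add: a0_def)
    show "a3 * a0 < a2 * a1" using hd(2) by (simp only: a_defs)
  qed
  \<comment> \<open>The transformed cubic is written homogeneously in \<open>l - 1\<close> and
    \<open>l + 1\<close>, so that the identity holds before \<open>l = -1\<close> is excluded. The
    factor 8 clears the halves in \<open>l = ((l + 1) + (l - 1)) / 2\<close> and
    \<open>1 = ((l + 1) - (l - 1)) / 2\<close>.\<close>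
  have eq: "of_real a3 * (l - 1) ^ 3 + of_real a2 * (l - 1)\<^sup>2 * (l + 1) + of_real a1 * (l - 1) * (l + 1)\<^sup>2
      + of_real a0 * (l + 1) ^ 3
     = 8 * ((l - 1 + \<omega>) * (l - 1) * (l - 1 + \<theta>) + \<beta> * l * (l - 1 + \<theta>) + \<gamma> * l * (l - 1))"
    by (simp add: a_defs q_def S_def power2_eq_square power3_eq_cube algebra_simps)
  have eq0: "of_real a3 * (l - 1) ^ 3 + of_real a2 * (l - 1)\<^sup>2 * (l + 1) + of_real a1 * (l - 1) * (l + 1)\<^sup>2
      + of_real a0 * (l + 1) ^ 3 = 0"
    unfolding eq root by simp
  \<comment> \<open>At \<open>l = -1\<close> only the term with \<open>a3\<close> survives, and it
    is nonzero.\<close>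
  have nz: "l + 1 \<noteq> 0"
  proof
    assume "l + 1 = 0"
    then show False using eq0 pos by auto
  qed
  define s where "s = (l - 1) / (l + 1)"
  have ls: "l - 1 = s * (l + 1)" using nz by (simp add: s_def)
  have "(l + 1) ^ 3 * (of_real a3 * s ^ 3 + of_real a2 * s\<^sup>2 + of_real a1 * s + of_real a0) = 0"
    using eq0 unfolding ls by (simp add: power2_eq_square power3_eq_cube algebra_simps)
  then have "of_real a3 * s ^ 3 + of_real a2 * s\<^sup>2 + of_real a1 * s + of_real a0 = 0" using nz by simp
  moreover have "0 \<le> Re s"
  proof -
    have "Re s = ((norm l)\<^sup>2 - 1) / (norm (l + 1))\<^sup>2"
      unfolding s_def Re_divide cmod_power2 by (simp add: power2_eq_square algebra_simps)
    moreover have "1 \<le> (norm l)\<^sup>2" using l by simp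
    ultimately show ?thesis by simp
  qed
  ultimately have "s = 0" using routh_hurwitz_cubic[OF pos] by blast
  then show ?thesis using ls by simp
qed

text \<open>Here \<eta> and \<zeta> stand for the couplings of \<open>x\<close> with the blocks
  \<open>y\<close> and \<open>z\<close>, and \<open>E1\<close>, \<open>E2\<close>, \<open>E3\<close>
  are the paired block rows. The quotients \<open>b / a\<close> and \<open>c / a\<close> are bounded
  by \<mu> and \<nu>, so the parameter bounds carry over from the extreme eigenvalues to \<beta> and
  \<gamma>.\<close>

lemma gsor_scalar_system:
  fixes \<omega> \<tau> \<theta> \<mu> \<nu> a b c :: real and \<eta> \<zeta> l :: complex
  assumes \<theta>: "0 < \<theta>" "\<theta> < 2"
    and \<omega>: "0 < \<omega>" "\<omega> < 4 * (2 - \<theta>) / ((2 - \<theta>) * (2 + \<tau> * \<mu>) + 2 * \<theta> * \<nu>)"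
    and \<tau>: "0 < \<tau>" "\<tau> < 4 * (\<omega> + \<theta> - \<omega> * \<theta>) / (\<omega> * \<theta> * \<mu>)"
    and a: "0 < a" and b: "0 \<le> b" "b \<le> \<mu> * a" and c: "0 \<le> c" "c \<le> \<nu> * a"
    and E1: "(1 - \<omega>) * a - \<omega> * \<eta> - \<omega> * \<zeta> = l * a"
    and E2: "\<eta> = l * (\<eta> - \<tau> * b)"
    and E3: "(1 - \<theta>) * \<zeta> = l * (\<zeta> - \<theta> * c)"
    and l: "1 \<le> norm l"
  shows "l = 1"
proof -
  define \<beta> \<gamma> where "\<beta> = \<omega> * \<tau> * (b / a)" and "\<gamma> = \<omega> * \<theta> * (c / a)"
  have ba: "0 \<le> b / a" "b / a \<le> \<mu>" and ca: "0 \<le> c / a" "c / a \<le> \<nu>"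
    using a b c by (auto simp: pos_divide_le_eq)
  have \<nu>: "0 \<le> \<nu>" using ca by linarith
  \<comment> \<open>Division by 0 yields 0, so \<mu> = 0 would turn the upper bound on \<tau> into
    \<tau> < 0.\<close>
  have "\<mu> \<noteq> 0" using \<tau> by auto
  then have \<mu>: "0 < \<mu>" using ba by linarith
  have \<tau>': "\<tau> * (\<omega> * \<theta> * \<mu>) < 4 * (\<omega> + \<theta> - \<omega> * \<theta>)"
    using \<tau>(2) \<omega>(1) \<theta>(1) \<mu> by (simp add: pos_less_divide_eq)
  have "0 < (2 - \<theta>) * (2 + \<tau> * \<mu>) + 2 * \<theta> * \<nu>"
    using \<theta> \<tau>(1) \<mu> \<nu> by (intro add_pos_nonneg mult_pos_pos) auto
  then have \<omega>': "\<omega> * ((2 - \<theta>) * (2 + \<tau> * \<mu>) + 2 * \<theta> * \<nu>) < 4 * (2 - \<theta>)"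
    using \<omega>(2) by (simp add: pos_less_divide_eq)
  have \<beta>: "0 \<le> \<beta>" "\<beta> \<le> \<omega> * \<tau> * \<mu>" and \<gamma>: "0 \<le> \<gamma>" "\<gamma> \<le> \<omega> * \<theta> * \<nu>"
    using mult_left_mono[OF ba(1), of "\<omega> * \<tau>"] mult_left_mono[OF ba(2), of "\<omega> * \<tau>"]
      mult_left_mono[OF ca(1), of "\<omega> * \<theta>"] mult_left_mono[OF ca(2), of "\<omega> * \<theta>"]
      \<omega>(1) \<tau>(1) \<theta>(1) unfolding \<beta>_def \<gamma>_def by simp_all
  have t\<nu>: "0 \<le> \<omega> * \<theta> * \<nu>" using \<omega>(1) \<theta>(1) \<nu> by simp
  have up0: "2 * (\<omega> * \<theta> * \<nu>) < (2 - \<theta>) * (4 - 2 * \<omega> - \<omega> * \<tau> * \<mu>)"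
    using \<omega>' by (simp add: algebra_simps)
  \<comment> \<open>The bound on \<omega> already contains \<omega> < 2, obtained by discarding the
    nonnegative \<nu> term and then the \<mu> term.\<close>
  have "0 < (2 - \<theta>) * (4 - 2 * \<omega> - \<omega> * \<tau> * \<mu>)" using up0 t\<nu> by linarith
  then have "0 < 4 - 2 * \<omega> - \<omega> * \<tau> * \<mu>" using \<theta> by (simp add: zero_less_mult_iff)
  then have \<omega>2: "\<omega> < 2" using \<beta> by linarith
  have "(2 - \<theta>) * (4 - 2 * \<omega> - \<omega> * \<tau> * \<mu>) \<le> (2 - \<theta>) * (4 - 2 * \<omega> - \<beta>)"
    using \<beta> \<theta> by (intro mult_left_mono) auto
  then have up: "2 * \<gamma> < (2 - \<theta>) * (4 - 2 * \<omega> - \<beta>)" using up0 \<gamma> by linarith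
  have "\<theta> * \<beta> \<le> \<theta> * (\<omega> * \<tau> * \<mu>)" using \<beta> \<theta> by (intro mult_left_mono) auto
  then have up': "\<theta> * \<beta> < 4 * (\<omega> + \<theta> - \<omega> * \<theta>)" using \<tau>' by (simp add: algebra_simps)
  have E2': "(l - 1) * \<eta> = l * \<tau> * b" and E3': "(l - 1 + \<theta>) * \<zeta> = l * \<theta> * c"
    using E2 E3 by (simp_all add: algebra_simps)
  have E1': "(l - 1 + \<omega>) * a + \<omega> * \<eta> + \<omega> * \<zeta> = 0" using E1 by (simp add: algebra_simps)
  \<comment> \<open>Multiplying the first row, instead of solving the others for \<eta> and \<zeta>,
    avoids separate cases for \<open>l = 1\<close> and \<open>l = 1 - \<theta>\<close>.\<close>
  have "0 = (l - 1) * (l - 1 + \<theta>) * ((l - 1 + \<omega>) * a + \<omega> * \<eta> + \<omega> * \<zeta>)"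
    unfolding E1' by simp
  also have "\<dots> = (l - 1 + \<omega>) * (l - 1) * (l - 1 + \<theta>) * a + \<omega> * (l - 1 + \<theta>) * ((l - 1) * \<eta>)
      + \<omega> * (l - 1) * ((l - 1 + \<theta>) * \<zeta>)"
    by (simp add: algebra_simps)
  also have "\<dots> = a * ((l - 1 + \<omega>) * (l - 1) * (l - 1 + \<theta>) + \<beta> * l * (l - 1 + \<theta>) + \<gamma> * l * (l - 1))"
  proof -
    have "of_real b = (of_real (b / a) * of_real a :: complex)"
      "of_real c = (of_real (c / a) * of_real a :: complex)"
      using a by simp_all
    then show ?thesis unfolding E2' E3' \<beta>_def \<gamma>_def of_real_mult by (simp only: algebra_simps)
  qed
  finally have "(l - 1 + \<omega>) * (l - 1) * (l - 1 + \<theta>) + \<beta> * l * (l - 1 + \<theta>) + \<gamma> * l * (l - 1) = 0"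
    using a by auto
  from gsor_cubic_root[OF \<theta> \<omega>(1) \<omega>2 \<beta>(1) \<gamma>(1) up up' this l] show ?thesis .
qed

section \<open>Positive definite matrices and Rayleigh quotients\<close>

text \<open>A maximal independent set of columns has \<open>m\<close> elements and is a basis, so
  the columns span the whole space. A vector orthogonal to all of them is then orthogonal to every
  unit vector.\<close>

lemma full_row_rank_transpose_kernel:
  fixes B :: "'a :: field mat"
  assumes B: "B \<in> carrier_mat m n" and r: "vec_space.rank m B = m"
    and y: "y \<in> carrier_vec m" and By: "transpose_mat B *\<^sub>v y = 0\<^sub>v n"
  shows "y = 0\<^sub>v m"
proof -
  interpret vec_space "TYPE('a)" m .
  have cols: "set (cols B) \<subseteq> carrier_vec m" using B cols_dim by blast
  let ?P = "\<lambda>T. T \<subseteq> set (cols B) \<and> lin_indpt T"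
  have "\<exists>A. finite A \<and> maximal A ?P \<and> {} \<subseteq> A"
    by (rule maximal_exists_superset[of "set (cols B)"]) (auto simp: lin_dep_def)
  then obtain U where U: "maximal U ?P" by blast
  then have U': "U \<subseteq> set (cols B)" "lin_indpt U" by (auto simp: maximal_def)
  have "card U = m" using rank_card_indpt[OF B U] r by simp
  then have "basis U"
    using U' cols by (intro dim_li_is_basis) (auto simp: dim_is_n intro: finite_subset)
  then have "carrier_vec m \<subseteq> span (set (cols B))"
    using span_is_monotone[OF U'(1)] by (auto simp: basis_def)
  then have span: "carrier_vec m \<subseteq> col_space B" by (simp add: col_space_def)
  have orth: "y \<bullet> v = 0" if "v \<in> carrier_vec m" for v
  proof -
    have "v \<in> col_space B" using span that by blast
    then obtain x where x: "x \<in> carrier_vec n" "B *\<^sub>v x = v"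
      unfolding col_space_eq[OF B] using B by auto
    then show ?thesis using transpose_vec_mult_scalar[OF B x(1) y] By by simp
  qed
  show ?thesis
  proof (rule eq_vecI)
    fix i assume "i < dim_vec (0\<^sub>v m :: 'a vec)"
    then show "y $ i = 0\<^sub>v m $ i" using orth[of "unit_vec m i"] y by simp
  qed (use y in simp)
qed

section \<open>Inverses and semidefinite quadratic forms\<close>

lemma mat_inv:
  fixes M :: "'a :: field mat"
  assumes M: "M \<in> carrier_mat k k" and det: "det M \<noteq> 0"
  shows "mat_inv M \<in> carrier_mat k k" "M * mat_inv M = 1\<^sub>m k" "mat_inv M * M = 1\<^sub>m k"
proof -
  have "M \<in> Units (ring_mat TYPE('a) k undefined)" by (rule det_non_zero_imp_unit[OF M det])
  then obtain N where N: "mat_inverse M = Some N" 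
    using mat_inverse(1)[OF M, of undefined] by (cases "mat_inverse M") auto
  then show "mat_inv M \<in> carrier_mat k k" "M * mat_inv M = 1\<^sub>m k" "mat_inv M * M = 1\<^sub>m k"
    using mat_inverse(2)[OF M N] by (simp_all add: mat_inv_def)
qed

lemma sym_pos_defD:
  assumes "sym_pos_def k M"
  shows "M \<in> carrier_mat k k" "transpose_mat M = M"
    "v \<in> carrier_vec k \<Longrightarrow> v \<noteq> 0\<^sub>v k \<Longrightarrow> 0 < v \<bullet> (M *\<^sub>v v)"
    "v \<in> carrier_vec k \<Longrightarrow> 0 \<le> v \<bullet> (M *\<^sub>v v)"
    "det M \<noteq> 0"
proof -
  show M: "M \<in> carrier_mat k k" "transpose_mat M = M"
    and pos: "\<And>v. v \<in> carrier_vec k \<Longrightarrow> v \<noteq> 0\<^sub>v k \<Longrightarrow> 0 < v \<bullet> (M *\<^sub>v v)"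
    using assms by (auto simp: sym_pos_def_def)
  show "0 \<le> v \<bullet> (M *\<^sub>v v)" if "v \<in> carrier_vec k"
    using pos[OF that] M that by (cases "v = 0\<^sub>v k") auto
  show "det M \<noteq> 0"
  proof
    assume "det M = 0"
    then obtain v where v: "v \<in> carrier_vec k" "v \<noteq> 0\<^sub>v k" "M *\<^sub>v v = 0\<^sub>v k"
      using det_0_iff_vec_prod_zero[OF M(1)] by blast
    then show False using pos[OF v(1,2)] by simp
  qed
qed

lemmas sym_pos_def_inv = mat_inv[OF sym_pos_defD(1) sym_pos_defD(5)]

text \<open>The substitution \<open>u = mat_inv M *\<^sub>v v\<close> turns the form of the inverse
  at \<open>v\<close> into the form of \<open>M\<close> at \<open>u\<close>.\<close>

lemma sym_pos_def_inv_nonneg: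
  assumes M: "sym_pos_def k M" and v: "v \<in> carrier_vec k"
  shows "0 \<le> v \<bullet> (mat_inv M *\<^sub>v v)"
proof -
  note inv = sym_pos_def_inv[OF M M]
  define u where "u = mat_inv M *\<^sub>v v"
  have u: "u \<in> carrier_vec k" using inv v by (simp add: u_def)
  have "M *\<^sub>v u = v" using sym_pos_defD(1)[OF M] inv v
    by (simp add: u_def assoc_mult_mat_vec[symmetric])
  then have "v \<bullet> u = u \<bullet> (M *\<^sub>v u)" using u v comm_scalar_prod by metis
  then show ?thesis using sym_pos_defD(4)[OF M u] by (simp add: u_def)
qed

lemma transpose_sym_pos_def_inv:
  assumes M: "sym_pos_def k M"
  shows "transpose_mat (mat_inv M) = mat_inv M"
proof -
  note inv = sym_pos_def_inv[OF M M]
  let ?N = "transpose_mat (mat_inv M)"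
  have N: "?N \<in> carrier_mat k k" using inv by simp
  have "?N * M = transpose_mat (M * mat_inv M)"
    using sym_pos_defD(1,2)[OF M] inv transpose_mult by metis
  then have NM: "?N * M = 1\<^sub>m k" using inv by simp
  have "?N = ?N * (M * mat_inv M)" using N inv by simp
  also have "\<dots> = ?N * M * mat_inv M"
    using N inv sym_pos_defD(1)[OF M] by (simp add: assoc_mult_mat)
  finally show ?thesis using NM inv by simp
qed

text \<open>A zero of a semidefinite form is a minimum. Moving from \<open>v\<close> along
  \<open>w = M *\<^sub>v v\<close> gives \<open>2 * t * c + t\<^sup>2 * d\<close>, which takes
  negative values near \<open>t = 0\<close> unless \<open>c\<close>, the squared length of
  \<open>w\<close>, vanishes.\<close>

lemma quadratic_form_zero_imp_kernel:
  fixes M :: "real mat"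
  assumes M: "M \<in> carrier_mat k k" "transpose_mat M = M"
    and nonneg: "\<And>u. u \<in> carrier_vec k \<Longrightarrow> 0 \<le> u \<bullet> (M *\<^sub>v u)"
    and v: "v \<in> carrier_vec k" "v \<bullet> (M *\<^sub>v v) = 0"
  shows "M *\<^sub>v v = 0\<^sub>v k"
proof (rule ccontr)
  assume nz: "M *\<^sub>v v \<noteq> 0\<^sub>v k"
  define w where "w = M *\<^sub>v v"
  have w: "w \<in> carrier_vec k" using M v by (simp add: w_def)
  define c d where "c = w \<bullet> w" and "d = w \<bullet> (M *\<^sub>v w)"
  have c: "0 < c" using nz w conjugate_square_greater_0_vec[OF w] by (simp add: c_def w_def)
  have d: "0 \<le> d" using nonneg[OF w] by (simp add: d_def)
  have vMw: "v \<bullet> (M *\<^sub>v w) = c"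
    using transpose_vec_mult_scalar[OF M(1) w v(1)] M(2) by (simp add: c_def w_def)
  have "0 \<le> (v + t \<cdot>\<^sub>v w) \<bullet> (M *\<^sub>v (v + t \<cdot>\<^sub>v w))" for t
    using nonneg v w by simp
  moreover have "(v + t \<cdot>\<^sub>v w) \<bullet> (M *\<^sub>v (v + t \<cdot>\<^sub>v w)) = 2 * t * c + t\<^sup>2 * d" for t
  proof -
    have "M *\<^sub>v (v + t \<cdot>\<^sub>v w) = w + t \<cdot>\<^sub>v (M *\<^sub>v w)"
      using M v w by (simp add: mult_add_distrib_mat_vec mult_mat_vec w_def)
    then show ?thesis
      using v(2) vMw M(1) v(1) w
      by (simp add: add_scalar_prod_distrib[of _ k] scalar_prod_add_distrib[of _ k]
          c_def[symmetric] d_def[symmetric] w_def[symmetric] power2_eq_square algebra_simps)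
  qed
  ultimately have ineq: "0 \<le> 2 * t * c + t\<^sup>2 * d" for t by simp
  show False
  proof (cases "d = 0")
    case True
    then show False using ineq[of "-1"] c by simp
  next
    case False
    \<comment> \<open>The parabola in \<open>t\<close> has its minimum at
      \<open>- c / d\<close>.\<close>
    then have "c * c \<le> 0" using ineq[of "- c / d"] c d
      by (simp add: power2_eq_square field_simps)
    then show False using mult_pos_pos[OF c c] by linarith
  qed
qed

section \<open>Existence of a maximiser of the Rayleigh quotient\<close>

text \<open>The unit sphere is encoded by coordinate functions that vanish from index
  \<open>k\<close> on, which gives it the product topology. It is a closed subset of a product of
  intervals, and that product is compact by Tychonoff.\<close>

lemma compact_coordinate_sphere:
  "compact {f :: nat \<Rightarrow> real. (\<forall>i\<ge>k. f i = 0) \<and> (\<Sum>i<k. (f i)\<^sup>2) = 1}" (is "compact ?K")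
proof -
  let ?S = "\<lambda>i :: nat. {-1..1 :: real}"
  have "compactin (product_topology (\<lambda>_. euclidean) UNIV) (PiE UNIV ?S)"
    by (subst compactin_PiE) simp
  then have "compact (PiE UNIV ?S)"
    by (simp add: euclidean_product_topology)
  moreover have "closed ?K"
  proof -
    have "?K = (\<Inter>i\<in>{k..}. {f. f i = 0}) \<inter> {f. (\<Sum>i<k. (f i)\<^sup>2) = 1}" by auto
    moreover have "closed {f :: nat \<Rightarrow> real. f i = 0}" for i
      by (intro closed_Collect_eq continuous_on_product_coordinates continuous_intros)
    moreover have "closed {f :: nat \<Rightarrow> real. (\<Sum>i<k. (f i)\<^sup>2) = 1}"
      by (intro closed_Collect_eq continuous_intros continuous_on_product_coordinates)
    ultimately show ?thesis by (simp add: closed_Int closed_INT)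
  qed
  moreover have "?K \<subseteq> PiE UNIV ?S"
  proof
    fix f assume "f \<in> ?K"
    then have z: "\<forall>i\<ge>k. f i = 0" and s: "(\<Sum>i<k. (f i)\<^sup>2) = 1" by auto
    have "- 1 \<le> f i \<and> f i \<le> 1" for i
    proof -
      have "(f i)\<^sup>2 \<le> 1"
      proof (cases "i < k")
        case True
        then show ?thesis using s member_le_sum[of i "{..<k}" "\<lambda>i. (f i)\<^sup>2"] by simp
      qed (use z in simp)
      then have "\<bar>f i\<bar> \<le> 1" by (simp add: abs_square_le_1)
      then show ?thesis by linarith
    qed
    then show "f \<in> PiE UNIV ?S" by auto
  qed
  ultimately show ?thesis using compact_Int_closed[of "PiE UNIV ?S" ?K] by (simp add: Int_absorb1)
qed

lemma continuous_on_quadratic_form: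
  fixes M :: "real mat"
  assumes M: "M \<in> carrier_mat k k"
  shows "continuous_on X (\<lambda>f. vec k f \<bullet> (M *\<^sub>v vec k f))"
proof -
  have "vec k f \<bullet> (M *\<^sub>v vec k f) = (\<Sum>i<k. f i * (\<Sum>j<k. M $$ (i, j) * f j))" for f
    using M by (auto simp: scalar_prod_def lessThan_atLeast0 intro!: sum.cong)
  then show ?thesis
    by (auto intro!: continuous_intros continuous_on_subset[OF continuous_on_product_coordinates])
qed

text \<open>The quotient is continuous on the compact unit sphere and invariant under scaling, so a
  maximum on the sphere is global. The inequality is stated without dividing by
  \<open>v \<bullet> (A *\<^sub>v v)\<close> and so covers the zero vector too.\<close>

lemma rayleigh_quotient_attained:
  fixes A N :: "real mat"
  assumes k: "0 < k" and A: "sym_pos_def k A" and N: "N \<in> carrier_mat k k"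
  obtains v0 where "v0 \<in> carrier_vec k" "v0 \<noteq> 0\<^sub>v k"
    "\<And>v. v \<in> carrier_vec k \<Longrightarrow>
      v \<bullet> (N *\<^sub>v v) \<le> v0 \<bullet> (N *\<^sub>v v0) / (v0 \<bullet> (A *\<^sub>v v0)) * (v \<bullet> (A *\<^sub>v v))"
proof -
  let ?K = "{f :: nat \<Rightarrow> real. (\<forall>i\<ge>k. f i = 0) \<and> (\<Sum>i<k. (f i)\<^sup>2) = 1}"
  let ?R = "\<lambda>f. vec k f \<bullet> (N *\<^sub>v vec k f) / (vec k f \<bullet> (A *\<^sub>v vec k f))"
  have sq: "vec k f \<bullet> vec k f = (\<Sum>i<k. (f i)\<^sup>2)" for f :: "nat \<Rightarrow> real"
    by (auto simp: scalar_prod_def lessThan_atLeast0 power2_eq_square intro!: sum.cong)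
  have nz: "vec k f \<noteq> 0\<^sub>v k" if "f \<in> ?K" for f
    using that sq[of f] by auto
  have pos: "0 < vec k f \<bullet> (A *\<^sub>v vec k f)" if "f \<in> ?K" for f
    using sym_pos_defD(3)[OF A _ nz[OF that]] by simp
  \<comment> \<open>The first unit vector shows that the sphere is nonempty; it exists because
    \<open>k\<close> is positive.\<close>
  have "(\<lambda>i. if i = 0 then 1 else 0) \<in> ?K" using k
    by (auto simp: if_distrib[of "\<lambda>x. x\<^sup>2"] cong: if_cong)
  then have ne: "?K \<noteq> {}" by (metis empty_iff)
  have "vec k f \<bullet> (A *\<^sub>v vec k f) \<noteq> 0" if "f \<in> ?K" for f
    using pos[OF that] by simp
  then have "continuous_on ?K ?R"
    by (intro continuous_on_divide continuous_on_quadratic_form[OF N]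
        continuous_on_quadratic_form[OF sym_pos_defD(1)[OF A]]) (rule ballI)
  from continuous_attains_sup[OF compact_coordinate_sphere ne this]
  obtain f0 where f0: "f0 \<in> ?K" "\<And>f. f \<in> ?K \<Longrightarrow> ?R f \<le> ?R f0"
    by (rule bexE) (rule that, assumption, erule bspec)
  show ?thesis
  proof (rule that[of "vec k f0"])
    show "vec k f0 \<in> carrier_vec k" "vec k f0 \<noteq> 0\<^sub>v k" using nz[OF f0(1)] by auto
    fix v :: "real vec" assume v: "v \<in> carrier_vec k"
    show "v \<bullet> (N *\<^sub>v v) \<le> ?R f0 * (v \<bullet> (A *\<^sub>v v))"
    proof (cases "v = 0\<^sub>v k")
      case True
      then show ?thesis using N sym_pos_defD(1)[OF A] by simp
    next
      case False
      define r where "r = sqrt (v \<bullet> v)"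
      have vv: "0 < v \<bullet> v" using False conjugate_square_greater_0_vec[OF v] by simp
      then have r: "0 < r" "r\<^sup>2 = v \<bullet> v" by (simp_all add: r_def)
      define f where "f = (\<lambda>i. if i < k then v $ i / r else 0)"
      have vf: "vec k f = (1 / r) \<cdot>\<^sub>v v" using v by (auto simp: f_def)
      have "vec k f \<bullet> vec k f = 1" using v r(1) unfolding vf
        by (simp add: r(2)[symmetric] power2_eq_square)
      then have "f \<in> ?K" by (simp add: sq f_def)
      then have "?R f \<le> ?R f0" by (rule f0(2))
      moreover have "vec k f \<bullet> (M *\<^sub>v vec k f) = (v \<bullet> (M *\<^sub>v v)) / r\<^sup>2"
        if "M \<in> carrier_mat k k" for M
        using that v r(1) unfolding vf by (simp add: mult_mat_vec power2_eq_square)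
      ultimately have "v \<bullet> (N *\<^sub>v v) / (v \<bullet> (A *\<^sub>v v)) \<le> ?R f0"
        using N sym_pos_defD(1)[OF A] r(1) by simp
      then show ?thesis using sym_pos_defD(3)[OF A v False] by (simp add: pos_divide_le_eq)
    qed
  qed
qed

lemma smult_mat_mult_vec:
  fixes M :: "'a :: comm_ring_1 mat"
  shows "dim_vec v = dim_col M \<Longrightarrow> (c \<cdot>\<^sub>m M) *\<^sub>v v = c \<cdot>\<^sub>v (M *\<^sub>v v)"
  by (rule eq_vecI) auto

lemma transpose_smult: "transpose_mat (c \<cdot>\<^sub>m M) = c \<cdot>\<^sub>m transpose_mat M"
  by (rule eq_matI) auto

text \<open>Let \<open>t\<close> be the maximal quotient, attained at \<open>v0\<close>. Then
  \<open>t \<cdot>\<^sub>m A - N\<close> is positive semidefinite and its form vanishes at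
  \<open>v0\<close>, so \<open>v0\<close> lies in its kernel and is an eigenvector of
  \<open>mat_inv A * N\<close> for \<open>t\<close>. Hence \<open>t\<close> is at most the largest
  eigenvalue.\<close>

lemma max_eigenvalue_rayleigh:
  fixes A N :: "real mat"
  assumes A: "sym_pos_def k A" and N: "N \<in> carrier_mat k k" "transpose_mat N = N"
    and v: "v \<in> carrier_vec k"
  shows "v \<bullet> (N *\<^sub>v v) \<le> max_eigenvalue (mat_inv A * N) * (v \<bullet> (A *\<^sub>v v))"
proof (cases "k = 0")
  \<comment> \<open>In dimension 0 both forms are empty sums, so the unspecified maximum of an empty
    spectrum does no harm.\<close>
  case True
  then show ?thesis using v N sym_pos_defD(1)[OF A] by (simp add: scalar_prod_def)
next
  case False
  note Ac = sym_pos_defD(1)[OF A]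
  note inv = sym_pos_def_inv[OF A A]
  obtain v0 where v0: "v0 \<in> carrier_vec k" "v0 \<noteq> 0\<^sub>v k"
    and le: "\<And>v. v \<in> carrier_vec k \<Longrightarrow>
      v \<bullet> (N *\<^sub>v v) \<le> v0 \<bullet> (N *\<^sub>v v0) / (v0 \<bullet> (A *\<^sub>v v0)) * (v \<bullet> (A *\<^sub>v v))"
    using rayleigh_quotient_attained[OF _ A N(1)] False by blast
  define t where "t = v0 \<bullet> (N *\<^sub>v v0) / (v0 \<bullet> (A *\<^sub>v v0))"
  define M where "M = t \<cdot>\<^sub>m A - N"
  have M: "M \<in> carrier_mat k k" "transpose_mat M = M"
    using Ac N sym_pos_defD(2)[OF A] by (auto simp: M_def transpose_minus[of _ k k] transpose_smult)
  have Mv: "M *\<^sub>v u = t \<cdot>\<^sub>v (A *\<^sub>v u) - N *\<^sub>v u" if "u \<in> carrier_vec k" for u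
    using Ac N that by (simp add: M_def minus_mult_distrib_mat_vec[of _ k k] smult_mat_mult_vec)
  have Mq: "u \<bullet> (M *\<^sub>v u) = t * (u \<bullet> (A *\<^sub>v u)) - u \<bullet> (N *\<^sub>v u)" if "u \<in> carrier_vec k" for u
    using Ac N that by (simp add: Mv scalar_prod_minus_distrib[of _ k])
  have "M *\<^sub>v v0 = 0\<^sub>v k"
  proof (rule quadratic_form_zero_imp_kernel[OF M _ v0(1)])
    show "0 \<le> u \<bullet> (M *\<^sub>v u)" if "u \<in> carrier_vec k" for u
      using le[OF that] Mq[OF that] by (simp add: t_def)
    show "v0 \<bullet> (M *\<^sub>v v0) = 0"
      using Mq[OF v0(1)] sym_pos_defD(3)[OF A v0] by (simp add: t_def)
  qed
  then have Nv0: "N *\<^sub>v v0 = t \<cdot>\<^sub>v (A *\<^sub>v v0)"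
    unfolding Mv[OF v0(1)] using Ac N v0(1) by (auto simp: vec_eq_iff)
  have "(mat_inv A * N) *\<^sub>v v0 = mat_inv A *\<^sub>v (t \<cdot>\<^sub>v (A *\<^sub>v v0))"
    using inv N v0 by (simp add: assoc_mult_mat_vec Nv0)
  also have "\<dots> = t \<cdot>\<^sub>v (mat_inv A *\<^sub>v (A *\<^sub>v v0))"
    using inv(1) Ac v0(1) by (intro mult_mat_vec[of _ k k]) auto
  also have "mat_inv A *\<^sub>v (A *\<^sub>v v0) = mat_inv A * A *\<^sub>v v0"
    by (rule assoc_mult_mat_vec[OF inv(1) Ac v0(1), symmetric])
  also have "\<dots> = v0" using inv(3) v0(1) by simp
  finally have "t \<in> spectrum (mat_inv A * N)"
    using v0 inv N unfolding spectrum_def eigenvalue_def eigenvector_def by auto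
  moreover have "finite (spectrum (mat_inv A * N))"
    using inv N by (intro card_finite_spectrum(1)[of _ k]) auto
  ultimately have "t \<le> max_eigenvalue (mat_inv A * N)" by (simp add: max_eigenvalue_def)
  then have "t * (v \<bullet> (A *\<^sub>v v)) \<le> max_eigenvalue (mat_inv A * N) * (v \<bullet> (A *\<^sub>v v))"
    using sym_pos_defD(4)[OF A v] by (rule mult_right_mono)
  then show ?thesis using le[OF v] by (simp add: t_def)
qed

section \<open>Real quadratic forms on complex vectors\<close>

abbreviation cmat :: "real mat \<Rightarrow> complex mat" where
  "cmat \<equiv> map_mat complex_of_real"

lemma scalar_prod_sum_lessThan:
  "w \<in> carrier_vec k \<Longrightarrow> u \<bullet> w = (\<Sum>j<k. u $ j * w $ j)"
  by (simp add: scalar_prod_def lessThan_atLeast0)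

lemma mult_mat_vec_index_sum:
  assumes "M \<in> carrier_mat nr nc" "v \<in> carrier_vec nc" "i < nr"
  shows "(M *\<^sub>v v) $ i = (\<Sum>j<nc. M $$ (i, j) * v $ j)"
  using assms by (simp add: scalar_prod_sum_lessThan[OF assms(2)])

lemma Re_Im_cmat_mult_vec:
  assumes M: "M \<in> carrier_mat nr nc" and w: "w \<in> carrier_vec nc"
  shows "map_vec Re (cmat M *\<^sub>v w) = M *\<^sub>v map_vec Re w"
    and "map_vec Im (cmat M *\<^sub>v w) = M *\<^sub>v map_vec Im w"
proof -
  have cM: "cmat M \<in> carrier_mat nr nc" and rw: "map_vec Re w \<in> carrier_vec nc"
    and iw: "map_vec Im w \<in> carrier_vec nc" using M w by auto
  have entry: "(cmat M *\<^sub>v w) $ i = (\<Sum>j<nc. of_real (M $$ (i, j)) * w $ j)" if "i < nr" for i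
    unfolding mult_mat_vec_index_sum[OF cM w that] using M that by simp
  show "map_vec Re (cmat M *\<^sub>v w) = M *\<^sub>v map_vec Re w"
  proof (rule eq_vecI)
    fix i assume "i < dim_vec (M *\<^sub>v map_vec Re w)"
    then have i: "i < nr" using M by simp
    then show "map_vec Re (cmat M *\<^sub>v w) $ i = (M *\<^sub>v map_vec Re w) $ i"
      unfolding mult_mat_vec_index_sum[OF M rw i] using entry[OF i] M w by simp
  qed (use M in simp)
  show "map_vec Im (cmat M *\<^sub>v w) = M *\<^sub>v map_vec Im w"
  proof (rule eq_vecI)
    fix i assume "i < dim_vec (M *\<^sub>v map_vec Im w)"
    then have i: "i < nr" using M by simp
    then show "map_vec Im (cmat M *\<^sub>v w) $ i = (M *\<^sub>v map_vec Im w) $ i"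
      unfolding mult_mat_vec_index_sum[OF M iw i] using entry[OF i] M w by simp
  qed (use M in simp)
qed

text \<open>For symmetric \<open>M\<close> this is the Hermitian form of \<open>M\<close> at
  \<open>w\<close>. Having it as a real number makes order statements available.\<close>

definition cquad :: "real mat \<Rightarrow> complex vec \<Rightarrow> real" where
  "cquad M w = map_vec Re w \<bullet> (M *\<^sub>v map_vec Re w) + map_vec Im w \<bullet> (M *\<^sub>v map_vec Im w)"

lemma conjugate_scalar_prod_Re_Im:
  assumes u: "u \<in> carrier_vec k" and w: "w \<in> carrier_vec k"
  shows "conjugate u \<bullet> w = Complex
      (map_vec Re u \<bullet> map_vec Re w + map_vec Im u \<bullet> map_vec Im w)
      (map_vec Re u \<bullet> map_vec Im w - map_vec Im u \<bullet> map_vec Re w)"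
proof -
  have "map_vec Re w \<in> carrier_vec k" "map_vec Im w \<in> carrier_vec k" using w by auto
  note sp = this[THEN scalar_prod_sum_lessThan] scalar_prod_sum_lessThan[OF w]
  show ?thesis unfolding sp using u w
    by (simp add: complex_eq_iff sum.distrib sum_subtractf)
qed

text \<open>The imaginary part is the difference of the two mixed terms of \<open>Re w\<close> and
  \<open>Im w\<close>, which agree by symmetry of \<open>M\<close>.\<close>

lemma hermitian_form_eq_cquad:
  assumes M: "M \<in> carrier_mat k k" "transpose_mat M = M" and w: "w \<in> carrier_vec k"
  shows "conjugate w \<bullet> (cmat M *\<^sub>v w) = cquad M w"
proof -
  let ?r = "map_vec Re w" and ?i = "map_vec Im w"
  have ri: "?r \<in> carrier_vec k" "?i \<in> carrier_vec k" using w by auto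
  have "?r \<bullet> (M *\<^sub>v ?i) = (M *\<^sub>v ?r) \<bullet> ?i"
    using transpose_vec_mult_scalar[OF M(1) ri(2,1)] M(2) by simp
  also have "\<dots> = ?i \<bullet> (M *\<^sub>v ?r)" by (rule comm_scalar_prod[of _ k]) (use M ri in auto)
  finally show ?thesis
    using conjugate_scalar_prod_Re_Im[OF w, of "cmat M *\<^sub>v w"] M w
    by (simp add: Re_Im_cmat_mult_vec[OF M(1) w] cquad_def complex_of_real_def)
qed

lemma Re_Im_eq_zero:
  assumes "w \<in> carrier_vec k" "map_vec Re w = 0\<^sub>v k" "map_vec Im w = 0\<^sub>v k"
  shows "w = 0\<^sub>v k"
proof (rule eq_vecI)
  fix i assume "i < dim_vec (0\<^sub>v k :: complex vec)"
  then show "w $ i = 0\<^sub>v k $ i"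
    using assms(1) arg_cong[OF assms(2), of "\<lambda>v. v $ i"] arg_cong[OF assms(3), of "\<lambda>v. v $ i"]
    by (auto simp: complex_eq_iff)
qed (use assms in auto)

lemma cquad_pos:
  assumes M: "sym_pos_def k M" and w: "w \<in> carrier_vec k" "w \<noteq> 0\<^sub>v k"
  shows "0 < cquad M w"
proof -
  have c: "map_vec Re w \<in> carrier_vec k" "map_vec Im w \<in> carrier_vec k" using w by auto
  have "map_vec Re w \<noteq> 0\<^sub>v k \<or> map_vec Im w \<noteq> 0\<^sub>v k" using Re_Im_eq_zero w by blast
  then show ?thesis unfolding cquad_def
    using sym_pos_defD(3,4)[OF M c(1)] sym_pos_defD(3,4)[OF M c(2)] by (auto intro: add_pos_nonneg add_nonneg_pos)
qed

text \<open>\<open>B\<close> is real, so conjugation commutes with it. This identifies the coupling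
  terms of the first block row with those obtained from the second and third.\<close>

lemma adjoint_cmat:
  assumes B: "B \<in> carrier_mat m n" and x: "x \<in> carrier_vec n" and y: "y \<in> carrier_vec m"
  shows "conjugate x \<bullet> (cmat (transpose_mat B) *\<^sub>v y) = conjugate (cmat B *\<^sub>v x) \<bullet> y"
proof -
  have cB: "cmat B \<in> carrier_mat m n" using B by simp
  have cx: "conjugate x \<in> carrier_vec n" using x by simp
  have Bx: "conjugate (cmat B *\<^sub>v x) = cmat B *\<^sub>v conjugate x"
  proof (rule eq_vecI)
    fix i assume "i < dim_vec (cmat B *\<^sub>v conjugate x)"
    then have i: "i < m" using B by simp
    then show "conjugate (cmat B *\<^sub>v x) $ i = (cmat B *\<^sub>v conjugate x) $ i"
      unfolding mult_mat_vec_index_sum[OF cB cx i]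
      using B x mult_mat_vec_index_sum[OF cB x i] by (simp del: index_mult_mat_vec add: sum_conjugate conjugate_dist_mul)
  qed (use B in simp)
  have tB: "cmat (transpose_mat B) = transpose_mat (cmat B)" by (rule eq_matI) auto
  have By: "transpose_mat (cmat B) *\<^sub>v y \<in> carrier_vec n" using cB y by simp
  have cBx: "cmat B *\<^sub>v conjugate x \<in> carrier_vec m"
    by (rule mult_mat_vec_carrier[OF cB cx])
  show ?thesis
    unfolding Bx tB comm_scalar_prod[OF cx By] transpose_vec_mult_scalar[OF cB cx y]
    by (rule comm_scalar_prod[OF y cBx])
qed

lemma congruence_form:
  assumes B: "B \<in> carrier_mat m n" and Q: "Q \<in> carrier_mat m m" and v: "v \<in> carrier_vec n"
  shows "v \<bullet> ((transpose_mat B * Q * B) *\<^sub>v v) = (B *\<^sub>v v) \<bullet> (Q *\<^sub>v (B *\<^sub>v (v :: real vec)))"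
proof -
  have Bv: "B *\<^sub>v v \<in> carrier_vec m" and QBv: "Q *\<^sub>v (B *\<^sub>v v) \<in> carrier_vec m" using assms by auto
  have "(transpose_mat B * Q * B) *\<^sub>v v = transpose_mat B *\<^sub>v (Q *\<^sub>v (B *\<^sub>v v))"
    using assms by (simp add: assoc_mult_mat_vec[of _ n m _ n] assoc_mult_mat_vec[of _ n m _ m])
  moreover have "v \<bullet> \<dots> = \<dots> \<bullet> v" by (rule comm_scalar_prod[OF v]) (use B QBv in auto)
  ultimately show ?thesis
    using transpose_vec_mult_scalar[OF B v QBv] comm_scalar_prod[OF QBv Bv] by simp
qed

text \<open>The left side is the form of \<open>transpose_mat B * mat_inv P * B\<close> summed over
  real and imaginary part of \<open>x\<close>, and the Rayleigh bound applies to each part. With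
  \<open>D\<close> and \<open>C\<close> in place of \<open>P\<close> and \<open>B\<close> the same
  lemma yields the bound by \<nu>.\<close>

lemma cquad_inv_bounds:
  assumes A: "sym_pos_def n A" and P: "sym_pos_def m P" and B: "B \<in> carrier_mat m n"
    and x: "x \<in> carrier_vec n"
  shows "0 \<le> cquad (mat_inv P) (cmat B *\<^sub>v x)"
    and "cquad (mat_inv P) (cmat B *\<^sub>v x)
      \<le> max_eigenvalue (mat_inv A * transpose_mat B * mat_inv P * B) * cquad A x"
proof -
  let ?N = "transpose_mat B * mat_inv P * B"
  let ?r = "map_vec Re x" and ?i = "map_vec Im x"
  note inv = sym_pos_def_inv[OF A A] sym_pos_def_inv[OF P P]
  have ri: "?r \<in> carrier_vec n" "?i \<in> carrier_vec n" using x by auto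
  have N: "?N \<in> carrier_mat n n" using B inv by auto
  have Bt: "transpose_mat B \<in> carrier_mat n m" and BtP: "transpose_mat B * mat_inv P \<in> carrier_mat n m"
    using B inv by auto
  have "transpose_mat ?N = transpose_mat B * (transpose_mat (mat_inv P) * B)"
    unfolding transpose_mult[OF BtP B] transpose_mult[OF Bt inv(4)] by simp
  also have "\<dots> = ?N" unfolding transpose_sym_pos_def_inv[OF P] by (rule assoc_mult_mat[OF Bt inv(4) B, symmetric])
  finally have sym: "transpose_mat ?N = ?N" .
  have assoc: "mat_inv A * transpose_mat B * mat_inv P * B = mat_inv A * ?N"
    unfolding assoc_mult_mat[OF inv(1) Bt inv(4)] by (rule assoc_mult_mat[OF inv(1) BtP B])
  have eq: "cquad (mat_inv P) (cmat B *\<^sub>v x) = ?r \<bullet> (?N *\<^sub>v ?r) + ?i \<bullet> (?N *\<^sub>v ?i)"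
    unfolding cquad_def Re_Im_cmat_mult_vec[OF B x]
    by (simp only: congruence_form[OF B inv(4) ri(1)] congruence_form[OF B inv(4) ri(2)])
  show "0 \<le> cquad (mat_inv P) (cmat B *\<^sub>v x)"
    unfolding cquad_def Re_Im_cmat_mult_vec[OF B x]
    using B ri sym_pos_def_inv_nonneg[OF P] by (intro add_nonneg_nonneg) auto
  show "cquad (mat_inv P) (cmat B *\<^sub>v x)
      \<le> max_eigenvalue (mat_inv A * transpose_mat B * mat_inv P * B) * cquad A x"
    unfolding eq assoc cquad_def[of A] distrib_left
    by (intro add_mono max_eigenvalue_rayleigh[OF A N sym] ri)
qed

lemma full_row_rank_cmat_kernel:
  assumes B: "B \<in> carrier_mat m n" "vec_space.rank m B = m"
    and y: "y \<in> carrier_vec m" and By: "cmat (transpose_mat B) *\<^sub>v y = 0\<^sub>v n"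
  shows "y = 0\<^sub>v m"
proof (rule Re_Im_eq_zero[OF y])
  have Bt: "transpose_mat B \<in> carrier_mat n m" using B by simp
  have z: "map_vec Re (0\<^sub>v n) = 0\<^sub>v n" "map_vec Im (0\<^sub>v n) = 0\<^sub>v n" by auto
  show "map_vec Re y = 0\<^sub>v m" "map_vec Im y = 0\<^sub>v m"
    using Re_Im_cmat_mult_vec[OF Bt y] y unfolding By z
    by (auto intro!: full_row_rank_transpose_kernel[OF B])
qed

lemma cmat_kernel_sym_pos_def:
  assumes M: "sym_pos_def k M" and w: "w \<in> carrier_vec k" and Mw: "cmat M *\<^sub>v w = 0\<^sub>v k"
  shows "w = 0\<^sub>v k"
proof (rule ccontr)
  assume "w \<noteq> 0\<^sub>v k"
  then have "0 < cquad M w" by (rule cquad_pos[OF M w])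
  moreover have "complex_of_real (cquad M w) = 0"
    using hermitian_form_eq_cquad[OF sym_pos_defD(1,2)[OF M] w] w unfolding Mw by simp
  ultimately show False by simp
qed

section \<open>The block iteration matrix\<close>

text \<open>A four-block matrix takes its size from its two diagonal blocks alone.\<close>

lemma nine_block_mat_carrier:
  assumes "M11 \<in> carrier_mat n n" "M33 \<in> carrier_mat p p" "M22 \<in> carrier_mat m m"
  shows "nine_block_mat M11 M12 M13 M21 M22 M23 M31 M32 M33 \<in> carrier_mat (n + m + p) (n + m + p)"
  unfolding nine_block_mat_def by (intro four_block_carrier_mat assms)

lemma nine_block_mat_mult_vec:
  fixes M11 :: "'a :: comm_ring_1 mat"
  assumes M: "M11 \<in> carrier_mat n n" "M12 \<in> carrier_mat n m" "M13 \<in> carrier_mat n p"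
    "M21 \<in> carrier_mat m n" "M22 \<in> carrier_mat m m" "M23 \<in> carrier_mat m p"
    "M31 \<in> carrier_mat p n" "M32 \<in> carrier_mat p m" "M33 \<in> carrier_mat p p"
    and v: "x \<in> carrier_vec n" "y \<in> carrier_vec m" "z \<in> carrier_vec p"
  shows "nine_block_mat M11 M12 M13 M21 M22 M23 M31 M32 M33 *\<^sub>v ((x @\<^sub>v y) @\<^sub>v z) =
    ((M11 *\<^sub>v x + M12 *\<^sub>v y + M13 *\<^sub>v z) @\<^sub>v (M21 *\<^sub>v x + M22 *\<^sub>v y + M23 *\<^sub>v z))
      @\<^sub>v (M31 *\<^sub>v x + M32 *\<^sub>v y + M33 *\<^sub>v z)"
proof -
  have c: "four_block_mat M11 M12 M21 M22 \<in> carrier_mat (n + m) (n + m)"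
    "M13 @\<^sub>r M23 \<in> carrier_mat (n + m) p" "append_cols M31 M32 \<in> carrier_mat p (n + m)"
    using M by (auto simp: append_rows_def append_cols_def)
  have xy: "x @\<^sub>v y \<in> carrier_vec (n + m)" using v by simp
  have r: "(M13 @\<^sub>r M23) *\<^sub>v z = M13 *\<^sub>v z @\<^sub>v M23 *\<^sub>v z"
    by (rule mat_mult_append[OF M(3,6) v(3)])
  \<comment> \<open>The lower block row of \<open>append_cols\<close> is empty, so it contributes a
    vector of dimension 0.\<close>
  have "append_cols M31 M32 *\<^sub>v (x @\<^sub>v y)
      = (M31 *\<^sub>v x + M32 *\<^sub>v y) @\<^sub>v (0\<^sub>m 0 n *\<^sub>v x + 0\<^sub>m 0 m *\<^sub>v y)"
    unfolding append_cols_def using M v by (simp add: four_block_mat_mult_vec[of _ p n _ m _ 0])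
  also have "\<dots> = M31 *\<^sub>v x + M32 *\<^sub>v y" using M v by (auto intro!: eq_vecI)
  finally have cc: "append_cols M31 M32 *\<^sub>v (x @\<^sub>v y) = M31 *\<^sub>v x + M32 *\<^sub>v y" .
  show "nine_block_mat M11 M12 M13 M21 M22 M23 M31 M32 M33 *\<^sub>v ((x @\<^sub>v y) @\<^sub>v z) =
    ((M11 *\<^sub>v x + M12 *\<^sub>v y + M13 *\<^sub>v z) @\<^sub>v (M21 *\<^sub>v x + M22 *\<^sub>v y + M23 *\<^sub>v z))
      @\<^sub>v (M31 *\<^sub>v x + M32 *\<^sub>v y + M33 *\<^sub>v z)"
    unfolding nine_block_mat_def four_block_mat_mult_vec[OF c M(9) xy v(3)]
      four_block_mat_mult_vec[OF M(1,2,4,5) v(1,2)] r cc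
    using M v by (subst append_vec_add[of _ n _ _ m]) auto
qed

lemma map_nine_block_mat:
  assumes M: "M11 \<in> carrier_mat n n" "M12 \<in> carrier_mat n m" "M13 \<in> carrier_mat n p"
    "M21 \<in> carrier_mat m n" "M22 \<in> carrier_mat m m" "M23 \<in> carrier_mat m p"
    "M31 \<in> carrier_mat p n" "M32 \<in> carrier_mat p m" "M33 \<in> carrier_mat p p"
  shows "cmat (nine_block_mat M11 M12 M13 M21 M22 M23 M31 M32 M33) =
    nine_block_mat (cmat M11) (cmat M12) (cmat M13) (cmat M21) (cmat M22) (cmat M23)
      (cmat M31) (cmat M32) (cmat M33)"
proof -
  have c: "four_block_mat M11 M12 M21 M22 \<in> carrier_mat (n + m) (n + m)"
    "M13 @\<^sub>r M23 \<in> carrier_mat (n + m) p" "append_cols M31 M32 \<in> carrier_mat p (n + m)"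
    using M by (auto simp: append_rows_def append_cols_def)
  have "cmat (M13 @\<^sub>r M23) = cmat M13 @\<^sub>r cmat M23"
    using M by (auto intro!: eq_matI simp: append_rows_def)
  moreover have "cmat (append_cols M31 M32) = append_cols (cmat M31) (cmat M32)"
    using M by (auto intro!: eq_matI simp: append_cols_def)
  ultimately show ?thesis
    unfolding nine_block_mat_def map_four_block_mat[OF c M(9)] map_four_block_mat[OF M(1,2,4,5)] by (simp only:)
qed

lemma cmat_smult: "cmat (c \<cdot>\<^sub>m M) = complex_of_real c \<cdot>\<^sub>m cmat M"
  by (rule eq_matI) auto

lemma cmat_zero: "cmat (0\<^sub>m nr nc) = 0\<^sub>m nr nc"
  by (rule eq_matI) auto

lemma gsor_block_carrier:
  assumes "A \<in> carrier_mat n n" "D \<in> carrier_mat p p" "P \<in> carrier_mat m m"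
  shows "gsor_lhs A B C D P \<tau> \<theta> \<in> carrier_mat (n + m + p) (n + m + p)"
    and "gsor_rhs A B C D P \<omega> \<theta> \<in> carrier_mat (n + m + p) (n + m + p)"
  using assms by (auto simp: gsor_lhs_def gsor_rhs_def Let_def intro!: nine_block_mat_carrier)

lemma cmat_gsor_mult_vec:
  assumes M: "A \<in> carrier_mat n n" "B \<in> carrier_mat m n" "C \<in> carrier_mat p n"
    "D \<in> carrier_mat p p" "P \<in> carrier_mat m m"
    and v: "x \<in> carrier_vec n" "y \<in> carrier_vec m" "z \<in> carrier_vec p"
  shows "cmat (gsor_lhs A B C D P \<tau> \<theta>) *\<^sub>v ((x @\<^sub>v y) @\<^sub>v z) =
      (cmat A *\<^sub>v x @\<^sub>v (of_real (- \<tau>) \<cdot>\<^sub>v (cmat B *\<^sub>v x) + cmat P *\<^sub>v y))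
        @\<^sub>v (of_real (- \<theta>) \<cdot>\<^sub>v (cmat C *\<^sub>v x) + cmat D *\<^sub>v z)"
    and "cmat (gsor_rhs A B C D P \<omega> \<theta>) *\<^sub>v ((x @\<^sub>v y) @\<^sub>v z) =
      ((of_real (1 - \<omega>) \<cdot>\<^sub>v (cmat A *\<^sub>v x) + of_real (- \<omega>) \<cdot>\<^sub>v (cmat (transpose_mat B) *\<^sub>v y)
          + of_real (- \<omega>) \<cdot>\<^sub>v (cmat (transpose_mat C) *\<^sub>v z)) @\<^sub>v cmat P *\<^sub>v y)
        @\<^sub>v of_real (1 - \<theta>) \<cdot>\<^sub>v (cmat D *\<^sub>v z)"
proof -
  have dims: "dim_row A = n" "dim_row P = m" "dim_row D = p" using M by auto
  note defs = gsor_lhs_def gsor_rhs_def Let_def dims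
  have cM: "cmat A *\<^sub>v x \<in> carrier_vec n" "cmat B *\<^sub>v x \<in> carrier_vec m" "cmat C *\<^sub>v x \<in> carrier_vec p"
    "cmat P *\<^sub>v y \<in> carrier_vec m" "cmat D *\<^sub>v z \<in> carrier_vec p"
    "cmat (transpose_mat B) *\<^sub>v y \<in> carrier_vec n" "cmat (transpose_mat C) *\<^sub>v z \<in> carrier_vec n"
    using M v by (auto intro!: mult_mat_vec_carrier)
  have s: "(c \<cdot>\<^sub>m cmat A) *\<^sub>v x = c \<cdot>\<^sub>v (cmat A *\<^sub>v x)" "(c \<cdot>\<^sub>m cmat B) *\<^sub>v x = c \<cdot>\<^sub>v (cmat B *\<^sub>v x)"
    "(c \<cdot>\<^sub>m cmat C) *\<^sub>v x = c \<cdot>\<^sub>v (cmat C *\<^sub>v x)" "(c \<cdot>\<^sub>m cmat D) *\<^sub>v z = c \<cdot>\<^sub>v (cmat D *\<^sub>v z)"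
    "(c \<cdot>\<^sub>m cmat (transpose_mat B)) *\<^sub>v y = c \<cdot>\<^sub>v (cmat (transpose_mat B) *\<^sub>v y)"
    "(c \<cdot>\<^sub>m cmat (transpose_mat C)) *\<^sub>v z = c \<cdot>\<^sub>v (cmat (transpose_mat C) *\<^sub>v z)" for c
    using M v by (intro smult_mat_mult_vec; simp)+
  have z: "0\<^sub>m k n *\<^sub>v x = 0\<^sub>v k" "0\<^sub>m k m *\<^sub>v y = 0\<^sub>v k" "0\<^sub>m k p *\<^sub>v z = 0\<^sub>v k" for k
    using v by auto
  have L: "cmat (gsor_lhs A B C D P \<tau> \<theta>) = nine_block_mat (cmat A) (0\<^sub>m n m) (0\<^sub>m n p)
      (of_real (- \<tau>) \<cdot>\<^sub>m cmat B) (cmat P) (0\<^sub>m m p) (of_real (- \<theta>) \<cdot>\<^sub>m cmat C) (0\<^sub>m p m) (cmat D)"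
    unfolding defs
    by (subst map_nine_block_mat[of _ n _ m _ p]) (use M in \<open>simp_all only: cmat_smult cmat_zero, auto\<close>)
  have R: "cmat (gsor_rhs A B C D P \<omega> \<theta>) = nine_block_mat (of_real (1 - \<omega>) \<cdot>\<^sub>m cmat A)
      (of_real (- \<omega>) \<cdot>\<^sub>m cmat (transpose_mat B)) (of_real (- \<omega>) \<cdot>\<^sub>m cmat (transpose_mat C))
      (0\<^sub>m m n) (cmat P) (0\<^sub>m m p) (0\<^sub>m p n) (0\<^sub>m p m) (of_real (1 - \<theta>) \<cdot>\<^sub>m cmat D)"
    unfolding defs
    by (subst map_nine_block_mat[of _ n _ m _ p]) (use M in \<open>simp_all only: cmat_smult cmat_zero, auto\<close>)
  show "cmat (gsor_lhs A B C D P \<tau> \<theta>) *\<^sub>v ((x @\<^sub>v y) @\<^sub>v z) =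
      (cmat A *\<^sub>v x @\<^sub>v (of_real (- \<tau>) \<cdot>\<^sub>v (cmat B *\<^sub>v x) + cmat P *\<^sub>v y))
        @\<^sub>v (of_real (- \<theta>) \<cdot>\<^sub>v (cmat C *\<^sub>v x) + cmat D *\<^sub>v z)"
    unfolding L using M v cM by (subst nine_block_mat_mult_vec[of _ n _ m _ p]) (auto simp only: s z, auto)
  show "cmat (gsor_rhs A B C D P \<omega> \<theta>) *\<^sub>v ((x @\<^sub>v y) @\<^sub>v z) =
      ((of_real (1 - \<omega>) \<cdot>\<^sub>v (cmat A *\<^sub>v x) + of_real (- \<omega>) \<cdot>\<^sub>v (cmat (transpose_mat B) *\<^sub>v y)
          + of_real (- \<omega>) \<cdot>\<^sub>v (cmat (transpose_mat C) *\<^sub>v z)) @\<^sub>v cmat P *\<^sub>v y)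
        @\<^sub>v of_real (1 - \<theta>) \<cdot>\<^sub>v (cmat D *\<^sub>v z)"
    unfolding R using M v cM by (subst nine_block_mat_mult_vec[of _ n _ m _ p]) (auto simp only: s z, auto)
qed

lemma append3_cases:
  assumes "v \<in> carrier_vec (n + m + p)"
  obtains x y z where "x \<in> carrier_vec n" "y \<in> carrier_vec m" "z \<in> carrier_vec p"
    "v = (x @\<^sub>v y) @\<^sub>v z"
proof (rule that)
  show "v = (vec_first (vec_first v (n + m)) n @\<^sub>v vec_last (vec_first v (n + m)) m) @\<^sub>v vec_last v p"
    using assms by simp
qed auto

lemma append3_eq:
  assumes "x \<in> carrier_vec n" "x' \<in> carrier_vec n" "y \<in> carrier_vec m" "y' \<in> carrier_vec m"
  shows "(x @\<^sub>v y) @\<^sub>v z = (x' @\<^sub>v y') @\<^sub>v z' \<longleftrightarrow> x = x' \<and> y = y' \<and> z = z'"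
  using assms append_vec_eq[of "x @\<^sub>v y" "n + m" "x' @\<^sub>v y'" z z'] append_vec_eq[of x n x' y y'] by auto

lemma append3_zero: "(0\<^sub>v n @\<^sub>v 0\<^sub>v m) @\<^sub>v 0\<^sub>v p = (0\<^sub>v (n + m + p) :: 'a :: zero vec)"
  by (rule eq_vecI) auto

lemma append3_smult: "c \<cdot>\<^sub>v ((x @\<^sub>v y) @\<^sub>v z) = (c \<cdot>\<^sub>v x @\<^sub>v c \<cdot>\<^sub>v y) @\<^sub>v (c \<cdot>\<^sub>v z)"
  by (rule eq_vecI) auto

text \<open>The matrix is block lower triangular with nonsingular diagonal blocks. Forward
  substitution on a kernel vector gives first \<open>x = 0\<close>, then \<open>y = 0\<close> and
  \<open>z = 0\<close>. The argument runs over the complex numbers to share the block product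
  formulas.\<close>

lemma det_gsor_lhs:
  assumes A: "sym_pos_def n A" and D: "sym_pos_def p D" and P: "sym_pos_def m P"
    and B: "B \<in> carrier_mat m n" and C: "C \<in> carrier_mat p n"
  shows "det (gsor_lhs A B C D P \<tau> \<theta>) \<noteq> 0"
proof
  note M = sym_pos_defD(1)[OF A] B C sym_pos_defD(1)[OF D] sym_pos_defD(1)[OF P]
  let ?L = "gsor_lhs A B C D P \<tau> \<theta>"
  assume "det ?L = 0"
  then have "det (cmat ?L) = 0" by simp
  moreover have cL: "cmat ?L \<in> carrier_mat (n + m + p) (n + m + p)"
    using gsor_block_carrier(1)[OF M(1,4,5)] by simp
  ultimately obtain v where v: "v \<in> carrier_vec (n + m + p)" "v \<noteq> 0\<^sub>v (n + m + p)"
      "cmat ?L *\<^sub>v v = 0\<^sub>v (n + m + p)"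
    using det_0_iff_vec_prod_zero[OF cL] by blast
  obtain x y z where xyz: "x \<in> carrier_vec n" "y \<in> carrier_vec m" "z \<in> carrier_vec p"
    and vxyz: "v = (x @\<^sub>v y) @\<^sub>v z"
    using append3_cases[OF v(1)] .
  have cM: "cmat A *\<^sub>v x \<in> carrier_vec n" "cmat B *\<^sub>v x \<in> carrier_vec m" "cmat C *\<^sub>v x \<in> carrier_vec p"
    "cmat P *\<^sub>v y \<in> carrier_vec m" "cmat D *\<^sub>v z \<in> carrier_vec p"
    using M xyz by (auto intro!: mult_mat_vec_carrier)
  have eqs: "cmat A *\<^sub>v x = 0\<^sub>v n" "of_real (- \<tau>) \<cdot>\<^sub>v (cmat B *\<^sub>v x) + cmat P *\<^sub>v y = 0\<^sub>v m"
    "of_real (- \<theta>) \<cdot>\<^sub>v (cmat C *\<^sub>v x) + cmat D *\<^sub>v z = 0\<^sub>v p"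
    using v(3) cM unfolding vxyz cmat_gsor_mult_vec(1)[OF M xyz] append3_zero[symmetric]
    by (subst (asm) append3_eq[of _ n _ _ m]; auto)+
  have x: "x = 0\<^sub>v n" by (rule cmat_kernel_sym_pos_def[OF A xyz(1) eqs(1)])
  have z0: "cmat B *\<^sub>v x = 0\<^sub>v m" "cmat C *\<^sub>v x = 0\<^sub>v p" unfolding x using B C by auto
  have "c \<cdot>\<^sub>v 0\<^sub>v k = (0\<^sub>v k :: complex vec)" for c k by (rule eq_vecI) auto
  then have "cmat P *\<^sub>v y = 0\<^sub>v m" "cmat D *\<^sub>v z = 0\<^sub>v p"
    using eqs(2,3) cM unfolding z0 by simp_all
  then have "y = 0\<^sub>v m" "z = 0\<^sub>v p"
    using cmat_kernel_sym_pos_def[OF P xyz(2)] cmat_kernel_sym_pos_def[OF D xyz(3)] by auto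
  then show False using v(2) unfolding vxyz x append3_zero[symmetric] by simp
qed

section \<open>From eigenvectors to the scalar system\<close>

text \<open>Multiplying the eigenvalue equation by the left block matrix \<open>L\<close> gives the
  generalized problem \<open>R v = l L v\<close>, which no longer contains the block inverse and can
  be read off row by row.\<close>

lemma gsor_eigenvector_equations:
  assumes A: "sym_pos_def n A" and D: "sym_pos_def p D" and P: "sym_pos_def m P"
    and B: "B \<in> carrier_mat m n" and C: "C \<in> carrier_mat p n"
    and l: "l \<in> spectrum (cmat (gsor_mat A B C D P \<omega> \<tau> \<theta>))"
  obtains x y z where "x \<in> carrier_vec n" "y \<in> carrier_vec m" "z \<in> carrier_vec p"
    "\<not> (x = 0\<^sub>v n \<and> y = 0\<^sub>v m \<and> z = 0\<^sub>v p)"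
    "of_real (1 - \<omega>) \<cdot>\<^sub>v (cmat A *\<^sub>v x) + of_real (- \<omega>) \<cdot>\<^sub>v (cmat (transpose_mat B) *\<^sub>v y)
          + of_real (- \<omega>) \<cdot>\<^sub>v (cmat (transpose_mat C) *\<^sub>v z) = l \<cdot>\<^sub>v (cmat A *\<^sub>v x)"
    "cmat P *\<^sub>v y = l \<cdot>\<^sub>v (of_real (- \<tau>) \<cdot>\<^sub>v (cmat B *\<^sub>v x) + cmat P *\<^sub>v y)"
    "of_real (1 - \<theta>) \<cdot>\<^sub>v (cmat D *\<^sub>v z) = l \<cdot>\<^sub>v (of_real (- \<theta>) \<cdot>\<^sub>v (cmat C *\<^sub>v x) + cmat D *\<^sub>v z)"
proof -
  note M = sym_pos_defD(1)[OF A] B C sym_pos_defD(1)[OF D] sym_pos_defD(1)[OF P]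
  let ?L = "gsor_lhs A B C D P \<tau> \<theta>" and ?R = "gsor_rhs A B C D P \<omega> \<theta>"
  let ?N = "n + m + p"
  note LR = gsor_block_carrier[OF M(1,4,5)]
  note inv = mat_inv[OF LR(1) det_gsor_lhs[OF A D P B C]]
  let ?T = "mat_inv ?L * ?R"
  have T: "?T \<in> carrier_mat ?N ?N" by (rule mult_carrier_mat[OF inv(1) LR(2)])
  have LT: "?L * ?T = ?R"
    unfolding assoc_mult_mat[OF LR(1) inv(1) LR(2), symmetric] inv(2) by (rule left_mult_one_mat[OF LR(2)])
  from l obtain v where v: "v \<in> carrier_vec ?N" "v \<noteq> 0\<^sub>v ?N" "cmat ?T *\<^sub>v v = l \<cdot>\<^sub>v v"
    using T unfolding gsor_mat_def spectrum_def eigenvalue_def eigenvector_def by auto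
  obtain x y z where xyz: "x \<in> carrier_vec n" "y \<in> carrier_vec m" "z \<in> carrier_vec p"
    and vxyz: "v = (x @\<^sub>v y) @\<^sub>v z"
    using append3_cases[OF v(1)] .
  have cLT: "cmat ?L \<in> carrier_mat ?N ?N" "cmat ?T \<in> carrier_mat ?N ?N" using LR(1) T by auto
  have "cmat ?R *\<^sub>v v = cmat ?L *\<^sub>v (cmat ?T *\<^sub>v v)"
    unfolding assoc_mult_mat_vec[OF cLT v(1), symmetric] of_real_hom.mat_hom_mult[OF LR(1) T, symmetric] LT ..
  also have "\<dots> = l \<cdot>\<^sub>v (cmat ?L *\<^sub>v v)" unfolding v(3) by (rule mult_mat_vec[OF cLT(1) v(1)])
  finally have eq: "cmat ?R *\<^sub>v v = l \<cdot>\<^sub>v (cmat ?L *\<^sub>v v)" .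
  have cM: "cmat A *\<^sub>v x \<in> carrier_vec n" "cmat B *\<^sub>v x \<in> carrier_vec m" "cmat C *\<^sub>v x \<in> carrier_vec p"
    "cmat P *\<^sub>v y \<in> carrier_vec m" "cmat D *\<^sub>v z \<in> carrier_vec p"
    "cmat (transpose_mat B) *\<^sub>v y \<in> carrier_vec n" "cmat (transpose_mat C) *\<^sub>v z \<in> carrier_vec n"
    using M xyz by (auto intro!: mult_mat_vec_carrier)
  note eq' = eq[unfolded vxyz cmat_gsor_mult_vec(1,2)[OF M xyz] append3_smult]
  show ?thesis
  proof (rule that[OF xyz])
    show "\<not> (x = 0\<^sub>v n \<and> y = 0\<^sub>v m \<and> z = 0\<^sub>v p)"
      using v(2) unfolding vxyz append3_zero[symmetric] by blast
  qed (use eq' in \<open>subst (asm) append3_eq[of _ n _ _ m]; use cM in auto\<close>)+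
qed

text \<open>The second and third block rows share this shape, with
  \<open>(\<alpha>, \<beta>)\<close> equal to \<open>(1, - \<tau>)\<close> and
  \<open>(1 - \<theta>, - \<theta>)\<close>. Applying the inverse of \<open>Q\<close> gives the
  vector form, used when \<open>x = 0\<close>; pairing that with \<open>u\<close> gives the scalar
  form.\<close>

lemma preconditioned_row_scalar:
  assumes Q: "sym_pos_def k Q" and u: "u \<in> carrier_vec k" and y: "y \<in> carrier_vec k"
    and eq: "\<alpha> \<cdot>\<^sub>v (cmat Q *\<^sub>v y) = l \<cdot>\<^sub>v (\<beta> \<cdot>\<^sub>v u + cmat Q *\<^sub>v y)"
  shows "\<alpha> \<cdot>\<^sub>v y = l \<cdot>\<^sub>v (\<beta> \<cdot>\<^sub>v (cmat (mat_inv Q) *\<^sub>v u) + y)"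
    and "\<alpha> * (conjugate u \<bullet> y) = l * (\<beta> * cquad (mat_inv Q) u + conjugate u \<bullet> y)"
proof -
  note inv = sym_pos_def_inv[OF Q Q]
  note Qc = sym_pos_defD(1)[OF Q]
  let ?I = "cmat (mat_inv Q)"
  have I: "?I \<in> carrier_mat k k" and cQ: "cmat Q \<in> carrier_mat k k" using inv Qc by auto
  have IQ: "?I *\<^sub>v (cmat Q *\<^sub>v y) = y"
    unfolding assoc_mult_mat_vec[OF I cQ y, symmetric] of_real_hom.mat_hom_mult[OF inv(1) Qc, symmetric] inv(3)
    using y by (simp add: of_real_hom.mat_hom_one)
  have Qy: "cmat Q *\<^sub>v y \<in> carrier_vec k" and Iu: "?I *\<^sub>v u \<in> carrier_vec k"
    using I cQ u y by (auto intro!: mult_mat_vec_carrier)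
  have "?I *\<^sub>v (\<alpha> \<cdot>\<^sub>v (cmat Q *\<^sub>v y)) = \<alpha> \<cdot>\<^sub>v y"
    unfolding mult_mat_vec[OF I Qy] IQ ..
  moreover have "?I *\<^sub>v (l \<cdot>\<^sub>v (\<beta> \<cdot>\<^sub>v u + cmat Q *\<^sub>v y)) = l \<cdot>\<^sub>v (\<beta> \<cdot>\<^sub>v (?I *\<^sub>v u) + y)"
  proof -
    have "\<beta> \<cdot>\<^sub>v u \<in> carrier_vec k" "\<beta> \<cdot>\<^sub>v u + cmat Q *\<^sub>v y \<in> carrier_vec k" using u Qy by auto
    then show ?thesis
      by (simp only: mult_mat_vec[OF I] mult_add_distrib_mat_vec[OF I _ Qy] u IQ)
  qed
  ultimately show *: "\<alpha> \<cdot>\<^sub>v y = l \<cdot>\<^sub>v (\<beta> \<cdot>\<^sub>v (?I *\<^sub>v u) + y)" using eq by metis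
  have cu: "conjugate u \<in> carrier_vec k" using u by simp
  have "conjugate u \<bullet> (\<alpha> \<cdot>\<^sub>v y) = conjugate u \<bullet> (l \<cdot>\<^sub>v (\<beta> \<cdot>\<^sub>v (?I *\<^sub>v u) + y))" using * by simp
  also have "\<dots> = l * (\<beta> * (conjugate u \<bullet> (?I *\<^sub>v u)) + conjugate u \<bullet> y)"
    using cu Iu y by (simp add: scalar_prod_add_distrib[of _ k] del: index_mult_mat_vec)
  finally show "\<alpha> * (conjugate u \<bullet> y) = l * (\<beta> * cquad (mat_inv Q) u + conjugate u \<bullet> y)"
    unfolding hermitian_form_eq_cquad[OF inv(1) transpose_sym_pos_def_inv[OF Q] u] using cu y by simp
qed

lemma gsor_eigenvalue_norm:
  assumes A: "sym_pos_def n A" and D: "sym_pos_def p D" and P: "sym_pos_def m P"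
    and B: "B \<in> carrier_mat m n" "vec_space.rank m B = m" and C: "C \<in> carrier_mat p n"
    and mu: "\<mu> = max_eigenvalue (mat_inv A * transpose_mat B * mat_inv P * B)"
    and nu: "\<nu> = max_eigenvalue (mat_inv A * transpose_mat C * mat_inv D * C)"
    and \<theta>: "0 < \<theta>" "\<theta> < 2"
    and \<omega>: "0 < \<omega>" "\<omega> < 4 * (2 - \<theta>) / ((2 - \<theta>) * (2 + \<tau> * \<mu>) + 2 * \<theta> * \<nu>)"
    and \<tau>: "0 < \<tau>" "\<tau> < 4 * (\<omega> + \<theta> - \<omega> * \<theta>) / (\<omega> * \<theta> * \<mu>)"
    and spec: "l \<in> spectrum (cmat (gsor_mat A B C D P \<omega> \<tau> \<theta>))"
  shows "norm l < 1"
proof (rule ccontr)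
  assume "\<not> norm l < 1"
  then have l: "1 \<le> norm l" by simp
  obtain x y z where x: "x \<in> carrier_vec n" and y: "y \<in> carrier_vec m" and z: "z \<in> carrier_vec p"
    and nz: "\<not> (x = 0\<^sub>v n \<and> y = 0\<^sub>v m \<and> z = 0\<^sub>v p)"
    and E1: "of_real (1 - \<omega>) \<cdot>\<^sub>v (cmat A *\<^sub>v x) + of_real (- \<omega>) \<cdot>\<^sub>v (cmat (transpose_mat B) *\<^sub>v y)
          + of_real (- \<omega>) \<cdot>\<^sub>v (cmat (transpose_mat C) *\<^sub>v z) = l \<cdot>\<^sub>v (cmat A *\<^sub>v x)"
    and E2: "cmat P *\<^sub>v y = l \<cdot>\<^sub>v (of_real (- \<tau>) \<cdot>\<^sub>v (cmat B *\<^sub>v x) + cmat P *\<^sub>v y)"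
    and E3: "of_real (1 - \<theta>) \<cdot>\<^sub>v (cmat D *\<^sub>v z)
          = l \<cdot>\<^sub>v (of_real (- \<theta>) \<cdot>\<^sub>v (cmat C *\<^sub>v x) + cmat D *\<^sub>v z)"
    using gsor_eigenvector_equations[OF A D P B(1) C spec] .
  have Ac: "A \<in> carrier_mat n n" and Asym: "transpose_mat A = A" using sym_pos_defD(1,2)[OF A] .
  have cM: "cmat A *\<^sub>v x \<in> carrier_vec n" "cmat B *\<^sub>v x \<in> carrier_vec m" "cmat C *\<^sub>v x \<in> carrier_vec p"
    "cmat (transpose_mat B) *\<^sub>v y \<in> carrier_vec n" "cmat (transpose_mat C) *\<^sub>v z \<in> carrier_vec n"
    using Ac B(1) C x y z by (auto intro!: mult_mat_vec_carrier)
  have cx: "conjugate x \<in> carrier_vec n" using x by simp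
  define a b c where "a = cquad A x" and "b = cquad (mat_inv P) (cmat B *\<^sub>v x)"
    and "c = cquad (mat_inv D) (cmat C *\<^sub>v x)"
  define \<eta> \<zeta> where "\<eta> = conjugate (cmat B *\<^sub>v x) \<bullet> y" and "\<zeta> = conjugate (cmat C *\<^sub>v x) \<bullet> z"
  have E2': "1 \<cdot>\<^sub>v (cmat P *\<^sub>v y) = l \<cdot>\<^sub>v (of_real (- \<tau>) \<cdot>\<^sub>v (cmat B *\<^sub>v x) + cmat P *\<^sub>v y)"
    using E2 by simp
  note row2 = preconditioned_row_scalar[OF P cM(2) y E2']
  note row3 = preconditioned_row_scalar[OF D cM(3) z E3]
  have "conjugate x \<bullet> (l \<cdot>\<^sub>v (cmat A *\<^sub>v x)) = (1 - \<omega>) * (conjugate x \<bullet> (cmat A *\<^sub>v x))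
      - \<omega> * (conjugate x \<bullet> (cmat (transpose_mat B) *\<^sub>v y)) - \<omega> * (conjugate x \<bullet> (cmat (transpose_mat C) *\<^sub>v z))"
    unfolding E1[symmetric] using cx cM by (simp add: scalar_prod_add_distrib[of _ n])
  also have "conjugate x \<bullet> (l \<cdot>\<^sub>v (cmat A *\<^sub>v x)) = l * (conjugate x \<bullet> (cmat A *\<^sub>v x))"
    using cx cM by simp
  finally have S1: "(1 - \<omega>) * a - \<omega> * \<eta> - \<omega> * \<zeta> = l * a"
    unfolding hermitian_form_eq_cquad[OF Ac Asym x] adjoint_cmat[OF B(1) x y] adjoint_cmat[OF C x z]
    by (simp add: a_def \<eta>_def \<zeta>_def)
  have S2: "\<eta> = l * (\<eta> - \<tau> * b)" and S3: "(1 - \<theta>) * \<zeta> = l * (\<zeta> - \<theta> * c)"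
    using row2(2) row3(2) by (simp_all add: \<eta>_def \<zeta>_def b_def c_def algebra_simps)
  note b = cquad_inv_bounds[OF A P B(1) x, folded b_def a_def mu]
  note c = cquad_inv_bounds[OF A D C x, folded c_def a_def nu]
  have x0: "x = 0\<^sub>v n"
  proof (rule ccontr)
    assume "x \<noteq> 0\<^sub>v n"
    then have a: "0 < a" unfolding a_def by (rule cquad_pos[OF A x])
    have l1: "l = 1" by (rule gsor_scalar_system[OF \<theta> \<omega> \<tau> a b c S1 S2 S3 l])
    \<comment> \<open>At \<open>l = 1\<close> the second row reduces to \<tau> times this product
      being zero. Then \<eta> = 0, the third row gives \<zeta> = c, and the first becomes
      \<open>\<omega> * (a + c) = 0\<close>.\<close>
    have "cmat B *\<^sub>v x = 0\<^sub>v m"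
    proof (rule eq_vecI)
      fix i assume "i < dim_vec (0\<^sub>v m :: complex vec)"
      then have i: "i < m" by simp
      have "(cmat P *\<^sub>v y) $ i = of_real (- \<tau>) * (cmat B *\<^sub>v x) $ i + (cmat P *\<^sub>v y) $ i"
        using arg_cong[OF E2, of "\<lambda>v. v $ i"] l1 i B(1) sym_pos_defD(1)[OF P]
        by (simp del: index_mult_mat_vec)
      then show "(cmat B *\<^sub>v x) $ i = 0\<^sub>v m $ i" using \<tau>(1) i by (simp del: index_mult_mat_vec)
    qed (use B(1) in simp)
    then have "\<eta> = 0" using y by (simp add: \<eta>_def)
    then have "of_real (\<omega> * (a + c)) = (0 :: complex)"
      using S1 S3 \<theta>(1) l1 by (simp add: algebra_simps)
    then have "\<omega> * (a + c) = 0" by (simp only: of_real_eq_0_iff)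
    then show False using \<omega>(1) a c(1) by simp
  qed
  have z0: "cmat B *\<^sub>v x = 0\<^sub>v m" "cmat C *\<^sub>v x = 0\<^sub>v p" "cmat A *\<^sub>v x = 0\<^sub>v n"
    unfolding x0 using Ac B(1) C by auto
  have ev: "\<alpha> \<cdot>\<^sub>v w = l \<cdot>\<^sub>v w \<Longrightarrow> w \<in> carrier_vec k \<Longrightarrow> \<alpha> \<noteq> l \<Longrightarrow> w = 0\<^sub>v k" for \<alpha> w k
    by (auto simp: vec_eq_iff)
  have sz: "\<beta> \<cdot>\<^sub>v (cmat M *\<^sub>v 0\<^sub>v k) + w = w" if "M \<in> carrier_mat k k" "w \<in> carrier_vec k" for \<beta> M k w
    using that by (auto simp: vec_eq_iff)
  \<comment> \<open>With \<open>x = 0\<close> a nonzero \<open>z\<close> would force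
    \<open>l = 1 - \<theta>\<close>, whose modulus is below 1.\<close>
  have "of_real (1 - \<theta>) \<cdot>\<^sub>v z = l \<cdot>\<^sub>v z"
    using row3(1) unfolding z0 sz[OF sym_pos_def_inv(1)[OF D D] z] .
  moreover have "of_real (1 - \<theta>) \<noteq> l"
  proof
    assume "of_real (1 - \<theta>) = l"
    then have "norm l = \<bar>1 - \<theta>\<bar>" by (metis norm_of_real)
    then show False using l \<theta> by simp
  qed
  ultimately have zz: "z = 0\<^sub>v p" using ev z by blast
  have y1: "1 \<cdot>\<^sub>v y = l \<cdot>\<^sub>v y"
    using row2(1) unfolding z0 sz[OF sym_pos_def_inv(1)[OF P P] y] .
  \<comment> \<open>With \<open>x\<close> and \<open>z\<close> zero, the first row leaves only the
    term in \<open>y\<close>, with the nonzero factor \<open>- \<omega>\<close>.\<close>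
  have "cmat (transpose_mat B) *\<^sub>v y = 0\<^sub>v n"
  proof (rule eq_vecI)
    fix i assume "i < dim_vec (0\<^sub>v n :: complex vec)"
    then have i: "i < n" by simp
    have "cmat (transpose_mat C) *\<^sub>v z = 0\<^sub>v n" unfolding zz using C by auto
    then show "(cmat (transpose_mat B) *\<^sub>v y) $ i = 0\<^sub>v n $ i"
      using arg_cong[OF E1, of "\<lambda>v. v $ i"] i B(1) C \<omega>(1) unfolding z0
      by (simp del: index_mult_mat_vec)
  qed (use B(1) in simp)
  then have "y = 0\<^sub>v m" by (rule full_row_rank_cmat_kernel[OF B y])
  then show False using nz x0 zz by simp
qed

theorem theorem3p1:
  fixes n m p :: nat
    and A B C D P :: "real mat"
    and \<mu>_max \<nu>_max \<omega> \<tau> \<theta> :: real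
  assumes dims: "0 < n" "0 < m" "0 < p"
    and A: "sym_pos_def n A"
    and D: "sym_pos_def p D"
    and B: "B \<in> carrier_mat m n" "vec_space.rank m B = m"
    and C: "C \<in> carrier_mat p n"
    and P: "sym_pos_def m P"
    and mu: "\<mu>_max = max_eigenvalue (mat_inv A * transpose_mat B * mat_inv P * B)"
    and nu: "\<nu>_max = max_eigenvalue (mat_inv A * transpose_mat C * mat_inv D * C)"
    and theta: "0 < \<theta>" "\<theta> < 2"
    and omega: "0 < \<omega>"
      "\<omega> < 4 * (2 - \<theta>) / ((2 - \<theta>) * (2 + \<tau> * \<mu>_max) + 2 * \<theta> * \<nu>_max)"
    and tau: "0 < \<tau>"
      "\<tau> < 4 * (\<omega> + \<theta> - \<omega> * \<theta>) / (\<omega> * \<theta> * \<mu>_max)"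
  shows "gsor_convergent A B C D P \<omega> \<tau> \<theta>"
proof -
  note LR = gsor_block_carrier[OF sym_pos_defD(1)[OF A] sym_pos_defD(1)[OF D] sym_pos_defD(1)[OF P]]
  let ?T = "gsor_mat A B C D P \<omega> \<tau> \<theta>"
  have "?T \<in> carrier_mat (n + m + p) (n + m + p)"
    unfolding gsor_mat_def
    by (rule mult_carrier_mat[OF mat_inv(1)[OF LR(1) det_gsor_lhs[OF A D P B(1) C]] LR(2)])
  \<comment> \<open>Positive dimension makes the complex spectrum nonempty, so the spectral radius
    is the modulus of an actual eigenvalue.\<close>
  then have "spectral_radius (cmat ?T) \<in> norm ` spectrum (cmat ?T)"
    using dims by (intro spectral_radius_mem_max(1)[of _ "n + m + p"]) auto
  then show ?thesis
    unfolding gsor_convergent_def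
    using gsor_eigenvalue_norm[OF A D P B C mu nu theta omega tau] by auto
qed

end
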